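(* Let $\kappa$ be an uncountable cardinal. If $\lambda>\kappa$ is a strongly inaccessible cardinal, then there exists a $\kappa$-superuniversal rigid metric space of cardinality $\lambda$.
   Context: A metric space $X$ is $\kappa$-superuniversal if for every metric space $Y$ with $|Y|\leq\kappa$, every isometric embedding into $X$ of a subset of $Y$ of cardinality less than $\kappa$ extends to an isometric embedding of $Y$ into $X$. A metric space is rigid if its only isometry onto itself (distance-preserving bijection) is the identity. *)

theory Defs
  imports "HOL-Analysis.Abstract_Metric_Spaces"
begin

unbundle cardinal_syntax

definition isometric_embedding :: "'a metric \<Rightarrow> 'b metric \<Rightarrow> ('a \<Rightarrow> 'b) \<Rightarrow> bool" where
  "isometric_embedding Y X f \<longleftrightarrow>
     f \<in> mspace Y \<rightarrow> mspace X \<and>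
     (\<forall>x \<in> mspace Y. \<forall>y \<in> mspace Y. mdist X (f x) (f y) = mdist Y x y)"

definition rigid_metric :: "'a metric \<Rightarrow> bool" where
  "rigid_metric X \<longleftrightarrow>
     (\<forall>f. isometric_embedding X X f \<and> bij_betw f (mspace X) (mspace X)
        \<longrightarrow> (\<forall>x \<in> mspace X. f x = x))"

text \<open>
  A formula cannot quantify over types, so the test spaces below have their points in the type that
  carries the cardinal. Nothing is lost, since every space with at most \<open>\<kappa>\<close> points has an isometric
  copy there; see \<open>superuniversalD\<close>.
\<close>

definition superuniversal :: "'k rel \<Rightarrow> 'a metric \<Rightarrow> bool" where
  "superuniversal \<kappa> X \<longleftrightarrow>
     (\<forall>(Y :: 'k metric) S f.
        |mspace Y| \<le>o \<kappa> \<and> S \<subseteq> mspace Y \<and> |S| <o \<kappa> \<and>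
        isometric_embedding (submetric Y S) X f \<longrightarrow>
        (\<exists>g. isometric_embedding Y X g \<and> (\<forall>y \<in> S. g y = f y)))"

text \<open>
  Similarly, the smaller cardinals may be taken in the type of \<open>\<theta>\<close> itself, because
  every cardinal below \<open>\<theta>\<close> has a representative there; see \<open>strongly_inaccessibleD\<close>.
\<close>

definition strongly_inaccessible :: "'l rel \<Rightarrow> bool" where
  "strongly_inaccessible \<theta> \<longleftrightarrow>
     Card_order \<theta> \<and> natLeq <o \<theta> \<and> regularCard \<theta> \<and>
     (\<forall>\<mu> :: 'l rel. Card_order \<mu> \<and> \<mu> <o \<theta> \<longrightarrow> ctwo ^c \<mu> <o \<theta>)"

lemma superuniversalD:
  fixes Y :: "'b metric" and \<kappa> :: "'k rel"
  assumes \<kappa>: "Card_order \<kappa>" and X: "superuniversal \<kappa> X"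
    and Y: "|mspace Y| \<le>o \<kappa>" and S: "S \<subseteq> mspace Y" "|S| <o \<kappa>"
    and f: "isometric_embedding (submetric Y S) X f"
  shows "\<exists>g. isometric_embedding Y X g \<and> (\<forall>y \<in> S. g y = f y)"
proof -
  have "|mspace Y| \<le>o |Field \<kappa>|"
    using Y card_of_Field_ordIso[OF \<kappa>] ordIso_symmetric ordLeq_ordIso_trans by blast
  then obtain h :: "'b \<Rightarrow> 'k" where h: "inj_on h (mspace Y)"
    by (metis card_of_ordLeq)
  define k where "k = inv_into (mspace Y) h"
  define M where "M = h ` mspace Y"
  have kh: "k (h y) = y" if "y \<in> mspace Y" for y
    using that h by (simp add: k_def)
  have M: "Metric_space M (\<lambda>x y. mdist Y (k x) (k y))"
    by (rule Metric_space.intro)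
       (auto simp: M_def kh mdist_commute mdist_triangle inj_on_eq_iff[OF h])
  define Y' where "Y' = metric (M, \<lambda>x y. mdist Y (k x) (k y))"
  have sp: "mspace Y' = M" and ds: "mdist Y' = (\<lambda>x y. mdist Y (k x) (k y))"
    using M by (simp_all add: Y'_def Metric_space.mspace_metric Metric_space.mdist_metric)
  have 1: "|mspace Y'| \<le>o \<kappa>"
    unfolding sp M_def using card_of_image Y ordLeq_transitive by blast
  have 2: "h ` S \<subseteq> mspace Y'" "|h ` S| <o \<kappa>"
    using S card_of_image ordLeq_ordLess_trans by (auto simp: sp M_def) blast
  have 3: "isometric_embedding (submetric Y' (h ` S)) X (f \<circ> k)"
  proof -
    have "mspace (submetric Y' (h ` S)) = h ` S" "mspace (submetric Y S) = S"
      using 2(1) S(1) by auto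
    moreover have "k (h y) = y" if "y \<in> S" for y
      using that S(1) kh by blast
    ultimately show ?thesis
      using f by (auto simp: isometric_embedding_def ds Pi_iff)
  qed
  obtain g where g: "isometric_embedding Y' X g" "\<forall>y \<in> h ` S. g y = (f \<circ> k) y"
    using X 1 2 3 unfolding superuniversal_def by blast
  have "isometric_embedding Y X (g \<circ> h)"
    using g(1) by (auto simp: isometric_embedding_def sp ds kh M_def Pi_iff)
  moreover have "\<forall>y \<in> S. (g \<circ> h) y = f y"
    using g(2) S kh by auto
  ultimately show ?thesis by blast
qed

lemma strongly_inaccessibleD:
  fixes \<mu> :: "'m rel" and \<theta> :: "'l rel"
  assumes l: "strongly_inaccessible \<theta>" and "Card_order \<mu>" "\<mu> <o \<theta>"
  shows "ctwo ^c \<mu> <o \<theta>"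
proof -
  have "Card_order \<theta>" using l by (simp add: strongly_inaccessible_def)
  then have "|Field \<mu>| \<le>o |Field \<theta>|"
    using assms ordLess_imp_ordLeq card_of_mono2 by blast
  then obtain h :: "'m \<Rightarrow> 'l" where h: "inj_on h (Field \<mu>)"
    by (metis card_of_ordLeq)
  then have "|Field \<mu>| =o |h ` Field \<mu>|"
    using card_of_ordIsoI inj_on_imp_bij_betw by blast
  then have iso: "\<mu> =o |h ` Field \<mu>|"
    using card_of_Field_ordIso[OF assms(2)] ordIso_symmetric ordIso_transitive by blast
  then have "|h ` Field \<mu>| <o \<theta>"
    using assms(3) ordIso_symmetric ordIso_ordLess_trans by blast
  then have "ctwo ^c |h ` Field \<mu>| <o \<theta>"
    using l unfolding strongly_inaccessible_def by (metis card_of_Card_order)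
  moreover have "ctwo ^c \<mu> =o ctwo ^c |h ` Field \<mu>|"
    by (rule cexp_cong2[OF iso Card_order_ctwo assms(2)])
  ultimately show ?thesis using ordIso_ordLess_trans by blast
qed

end

theory Submission
  imports Defs
begin

text \<open>
  Adding points until every one-point metric type over a set of at most \<open>\<kappa>\<close> points is realized
  yields a superuniversal space, but left to itself such a space tends to be homogeneous. Rigidity is
  obtained by planting next to every point \<open>x\<close> an obstruction whose cardinality is a name of \<open>x\<close>.

  A \<^emph>\<open>marker\<close> of \<open>x\<close> is a large set \<open>A\<close> of points at distance \<open>2\<close> from \<open>x\<close> such that every point \<open>y\<close>
  satisfies \<open>d y a \<ge> 2 + min 1 (d y x)\<close> for all but fewer than \<open>|A|\<close> points \<open>a \<in> A\<close>. Hence \<open>x\<close> is the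
  only point that has distance at most \<open>2\<close> from \<open>|A|\<close> many elements of \<open>A\<close>. Markers of different points
  have different cardinalities. An isometry that moves \<open>x\<close> to \<open>y \<noteq> x\<close> would carry a marker of \<open>x\<close> to a
  set \<open>A'\<close> of the same cardinality for which \<open>y\<close> is the unique such point. So the space is rigid if
  every candidate \<open>A'\<close> of this kind is \<^emph>\<open>spoiled\<close>: some \<open>p \<noteq> y\<close> also has distance at most \<open>2\<close> from
  \<open>|A'|\<close> many elements of \<open>A'\<close>.

  What has to be checked is that points realizing types and points spoiling candidates do not destroy
  the markers already present. All points are added freely over a support \<open>Z\<close>, a set of pairs of a point
  and its prescribed distance: the distance to any other point \<open>w\<close> is the infimum of \<open>r + d s w\<close> over
  \<open>(s, r) \<in> Z\<close>. By regularity a free point respects every marker that has more elements than its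
  support (\<open>free_dist_marker\<close>), which settles the realization of types. To spoil a candidate
  \<open>A'\<close> for \<open>y\<close>, where \<open>|A'|\<close> is the cardinality of a marker of some \<open>x \<noteq> y\<close>, the support consists
  of most of \<open>A'\<close> at distance \<open>2\<close>, of \<open>y\<close> at a small distance, and of \<open>x\<close> at the distance
  it has from \<open>y\<close> (\<open>spoil\<close>). Larger markers are harmless as before. The markers of cardinality
  \<open>|A'|\<close> belong to \<open>x\<close>; as \<open>y\<close> is at distance \<open>2\<close> from \<open>A'\<close> and at distance at least
  \<open>2 + min 1 (d y x)\<close> from most of such a marker, the triangle inequality puts \<open>A'\<close> at
  distance at least \<open>min 1 (d y x)\<close> from most of it; this is enough since \<open>p\<close> is as far from \<open>x\<close> as \<open>y\<close> is.
  The smaller markers together have fewer than \<open>|A'|\<close> elements, each of which other than \<open>y\<close> is close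
  to fewer than \<open>|A'|\<close> elements of \<open>A'\<close>, so the part of \<open>A'\<close> close to them can be left out.

  The space is the union of a chain of spaces of cardinality below \<open>\<theta>\<close> (\<open>rich_stage_exists\<close>).
  Inaccessibility of \<open>\<theta>\<close> enters in three ways: below \<open>\<theta>\<close> there are always fresh successor cardinals for
  new markers; there are only \<open>\<theta>\<close> many tasks, so that a chain of length \<open>\<theta>\<close> can attend to each task
  cofinally often; and by regularity the members of the chain stay small and the data of each task lie
  in an early one.
\<close>

section \<open>One-point extensions of metric spaces\<close>

text \<open>
  The functions of distances from a possible new point; zeros are not excluded, so the new point may
  turn out to coincide with an old one.
\<close>

definition katetov :: "'a set \<Rightarrow> ('a \<Rightarrow> 'a \<Rightarrow> real) \<Rightarrow> ('a \<Rightarrow> real) \<Rightarrow> bool" where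
  "katetov M d F \<longleftrightarrow> (\<forall>x\<in>M. \<forall>y\<in>M. F x \<le> F y + d x y \<and> d x y \<le> F x + F y)"

definition extend_dist ::
    "'a set \<Rightarrow> ('a \<Rightarrow> 'a \<Rightarrow> real) \<Rightarrow> 'a set \<Rightarrow> ('a \<Rightarrow> real) \<Rightarrow> real \<Rightarrow> 'a \<Rightarrow> 'a \<Rightarrow> real" where
  "extend_dist M d N F c x y =
     (if x \<in> M \<and> y \<in> M then d x y
      else if x \<in> M \<and> y \<in> N then F x
      else if x \<in> N \<and> y \<in> M then F y
      else if x \<in> N \<and> y \<in> N \<and> x \<noteq> y then c else 0)"

text \<open>
  All new points have the same distances to the old ones, so besides positivity the only constraint on their mutual
  distance \<open>c\<close> is \<open>c \<le> 2 * F w\<close>. It is void when a single point is added.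
\<close>

lemma Metric_space_extend_dist:
  assumes M: "Metric_space M d" and disj: "M \<inter> N = {}"
    and F: "katetov M d F" "\<And>w. w \<in> M \<Longrightarrow> 0 < F w"
    and c: "\<And>n n'. \<lbrakk>n \<in> N; n' \<in> N; n \<noteq> n'\<rbrakk> \<Longrightarrow> 0 < c \<and> (\<forall>w\<in>M. c \<le> 2 * F w)"
  shows "Metric_space (M \<union> N) (extend_dist M d N F c)"
proof -
  interpret Metric_space M d by (rule M)
  let ?e = "extend_dist M d N F c"
  show ?thesis
  proof
    fix x y
    show "0 \<le> ?e x y"
      using F(2) c[of x y] by (auto simp: extend_dist_def less_imp_le)
    show "?e x y = ?e y x"
      by (cases "x \<in> M"; cases "y \<in> M") (simp_all add: extend_dist_def commute[of x] eq_commute[of x])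
  next
    fix x y assume "x \<in> M \<union> N" "y \<in> M \<union> N"
    then show "?e x y = 0 \<longleftrightarrow> x = y"
      using c[of x y] F(2)[of x] F(2)[of y]
      by (cases "x \<in> M"; cases "y \<in> M"; cases "x = y") (simp_all add: extend_dist_def)
  next
    fix x y z assume xyz: "x \<in> M \<union> N" "y \<in> M \<union> N" "z \<in> M \<union> N"
    have K: "F u \<le> F v + d u v" "d u v \<le> F u + F v" "F u \<le> d v u + F v"
      if "u \<in> M" "v \<in> M" for u v
      using F(1) that by (auto simp: katetov_def commute[of v] add.commute)
    have C: "0 < c" "c \<le> F u + F u" if "u \<in> M" "n \<in> N" "n' \<in> N" "n \<noteq> n'" for u n n'
      using c[of n n'] that by auto
    have C': "0 < c" if "n \<in> N" "n' \<in> N" "n \<noteq> n'" for n n'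
      using c[of n n'] that by auto
    have P: "0 \<le> F u" if "u \<in> M" for u
      using F(2)[OF that] by simp
    have eMM: "?e u v = d u v" if "u \<in> M" "v \<in> M" for u v
      using that by (simp add: extend_dist_def)
    have eMN: "?e u n = F u" "?e n u = F u" if "u \<in> M" "n \<in> N" for u n
      using that disj by (auto simp: extend_dist_def)
    have eNN: "?e n n' = (if n = n' then 0 else c)" if "n \<in> N" "n' \<in> N" for n n'
      using that disj by (auto simp: extend_dist_def)
    from xyz consider
        "x \<in> M" "y \<in> M" "z \<in> M" | "x \<in> M" "y \<in> M" "z \<in> N"
      | "x \<in> M" "y \<in> N" "z \<in> M" | "x \<in> M" "y \<in> N" "z \<in> N"
      | "x \<in> N" "y \<in> M" "z \<in> M" | "x \<in> N" "y \<in> M" "z \<in> N"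
      | "x \<in> N" "y \<in> N" "z \<in> M" | "x \<in> N" "y \<in> N" "z \<in> N"
      by blast
    then show "?e x z \<le> ?e x y + ?e y z"
    proof cases
      case 1 then show ?thesis by (simp add: eMM triangle)
    next
      case 2 then show ?thesis using K(1)[of x y] by (simp add: eMM eMN)
    next
      case 3 then show ?thesis using K(2)[of x z] by (simp add: eMM eMN)
    next
      case 4 then show ?thesis using C'[of y z] by (auto simp: eNN eMN less_imp_le)
    next
      case 5 then show ?thesis using K(3)[of z y] by (simp add: eMM eMN)
    next
      case 6 then show ?thesis using C[of y x z] P[of y] by (simp add: eNN eMN)
    next
      case 7 then show ?thesis using C'[of x y] by (auto simp: eNN eMN less_imp_le)
    next
      case 8 then show ?thesis using C'[of x y] C'[of y z] C'[of x z] by (auto simp: eNN less_imp_le)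
    qed
  qed
qed

text \<open>
  A prescription of distances from a new point to some of the points of \<open>M\<close>, given as a relation. Taking
  a pair twice shows that prescribed distances are nonnegative, and taking two pairs with the same
  point shows that the relation is a function.
\<close>

definition one_type :: "'a set \<Rightarrow> ('a \<Rightarrow> 'a \<Rightarrow> real) \<Rightarrow> ('a \<times> real) set \<Rightarrow> bool" where
  "one_type M d Z \<longleftrightarrow> fst ` Z \<subseteq> M \<and>
     (\<forall>(s, r)\<in>Z. \<forall>(t, q)\<in>Z. r \<le> q + d s t \<and> d s t \<le> r + q)"

lemma one_typeI:
  assumes "\<And>s r. (s, r) \<in> Z \<Longrightarrow> s \<in> M"
    and "\<And>s r t q. \<lbrakk>(s, r) \<in> Z; (t, q) \<in> Z\<rbrakk> \<Longrightarrow> r \<le> q + d s t \<and> d s t \<le> r + q"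
  shows "one_type M d Z"
  unfolding one_type_def using assms by auto

lemma one_typeD:
  assumes "one_type M d Z"
  shows "(s, r) \<in> Z \<Longrightarrow> s \<in> M"
    and "\<lbrakk>(s, r) \<in> Z; (t, q) \<in> Z\<rbrakk> \<Longrightarrow> r \<le> q + d s t \<and> d s t \<le> r + q"
  using assms unfolding one_type_def by force+

text \<open>
  The largest Katetov function with the prescribed values: the new point is amalgamated freely with \<open>M\<close>
  over the points mentioned in \<open>Z\<close>.
\<close>

definition free_dist :: "('a \<Rightarrow> 'a \<Rightarrow> real) \<Rightarrow> ('a \<times> real) set \<Rightarrow> 'a \<Rightarrow> real" where
  "free_dist d Z w = (INF (s, r)\<in>Z. r + d s w)"

locale nonempty_type = Metric_space M d for M :: "'a set" and d +
  fixes Z :: "('a \<times> real) set"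
  assumes type: "one_type M d Z" and nonempty: "Z \<noteq> {}"
begin

lemma in_M: "(s, r) \<in> Z \<Longrightarrow> s \<in> M"
  using type by (force simp: one_type_def)

lemma type_le: "\<lbrakk>(s, r) \<in> Z; (t, q) \<in> Z\<rbrakk> \<Longrightarrow> r \<le> q + d s t"
  and type_ge: "\<lbrakk>(s, r) \<in> Z; (t, q) \<in> Z\<rbrakk> \<Longrightarrow> d s t \<le> r + q"
  using type by (auto simp: one_type_def)

lemma type_nonneg: "(s, r) \<in> Z \<Longrightarrow> 0 \<le> r"
  using type_ge[of s r s r] nonneg[of s s] by linarith

lemma free_dist_le:
  assumes "(s, r) \<in> Z" shows "free_dist d Z w \<le> r + d s w"
proof -
  have "bdd_below ((\<lambda>(s, r). r + d s w) ` Z)"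
    using type_nonneg nonneg by (intro bdd_belowI2[of _ 0]) (auto intro: add_nonneg_nonneg)
  from cINF_lower[OF this assms] show ?thesis by (simp add: free_dist_def)
qed

lemma free_dist_greatest: "(\<And>s r. (s, r) \<in> Z \<Longrightarrow> c \<le> r + d s w) \<Longrightarrow> c \<le> free_dist d Z w"
  unfolding free_dist_def using nonempty by (intro cINF_greatest) auto

lemma free_dist_less:
  assumes "free_dist d Z w < c" obtains s r where "(s, r) \<in> Z" "r + d s w < c"
  using assms free_dist_greatest[of c w] by (meson not_le)

lemma free_dist_eq: "(s, r) \<in> Z \<Longrightarrow> free_dist d Z s = r"
proof (rule antisym)
  assume s: "(s, r) \<in> Z"
  show "free_dist d Z s \<le> r"
    using free_dist_le[OF s, of s] in_M[OF s] by simp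
  show "r \<le> free_dist d Z s"
    using type_le[OF s] by (intro free_dist_greatest) (simp add: commute)
qed

lemma katetov_free_dist: "katetov M d (free_dist d Z)"
  unfolding katetov_def
proof (intro ballI conjI)
  fix x y assume xy: "x \<in> M" "y \<in> M"
  have "free_dist d Z x - d x y \<le> free_dist d Z y"
  proof (rule free_dist_greatest)
    fix s r assume s: "(s, r) \<in> Z"
    show "free_dist d Z x - d x y \<le> r + d s y"
      using free_dist_le[OF s, of x] triangle[OF in_M[OF s] xy(2,1)] by (simp add: commute)
  qed
  then show "free_dist d Z x \<le> free_dist d Z y + d x y" by simp
  have "d x y - free_dist d Z y \<le> free_dist d Z x"
  proof (rule free_dist_greatest)
    fix s r assume s: "(s, r) \<in> Z"
    have "d x y - r - d s x \<le> free_dist d Z y"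
    proof (rule free_dist_greatest)
      fix t q assume t: "(t, q) \<in> Z"
      show "d x y - r - d s x \<le> q + d t y"
        using triangle[OF xy(1) in_M[OF s] xy(2)] triangle[OF in_M[OF s] in_M[OF t] xy(2)]
          type_ge[OF s t] by (simp add: commute)
    qed
    then show "d x y - free_dist d Z y \<le> r + d s x" by simp
  qed
  then show "d x y \<le> free_dist d Z x + free_dist d Z y" by simp
qed

end

section \<open>Marked points\<close>

lemma ordLess_subset: "\<lbrakk>A \<subseteq> B; |B| <o r\<rbrakk> \<Longrightarrow> |A| <o r"
  using card_of_mono1 ordLeq_ordLess_trans by blast

lemma ordLess_Un: "\<lbrakk>infinite C; |A| <o |C|; |B| <o |C| \<rbrakk> \<Longrightarrow> |A \<union> B| <o |C|"
  by (rule card_of_Un_ordLess_infinite)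

lemma finite_ordLess: "\<lbrakk>finite A; infinite B\<rbrakk> \<Longrightarrow> |A| <o |B|"
  by (intro finite_ordLess_infinite card_of_Well_order) (simp_all add: Field_card_of)

text \<open>
  The bound compares \<open>d y a\<close> with \<open>2 + d y x\<close>, the value it has when \<open>A\<close> is amalgamated freely at
  distance \<open>2\<close> over \<open>x\<close>. Truncating at \<open>1\<close> makes it suffice that \<open>y\<close> is at distance at least \<open>3\<close> from
  most of \<open>A\<close>, no matter how far \<open>y\<close> is from \<open>x\<close>; this matters for points that spoil candidates,
  whose distance to most marked points is not under control.
\<close>

definition marker :: "'a set \<Rightarrow> ('a \<Rightarrow> 'a \<Rightarrow> real) \<Rightarrow> 'a \<Rightarrow> 'a set \<Rightarrow> bool" where
  "marker M d x A \<longleftrightarrow> x \<in> M \<and> A \<subseteq> M \<and> (\<forall>a\<in>A. d x a = 2) \<and>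
     (\<forall>y\<in>M. |{a \<in> A. d y a < 2 + min 1 (d y x)}| <o |A| )"

lemma marker_subset: "marker M d x A \<Longrightarrow> A \<subseteq> M"
  by (simp add: marker_def)

text \<open>
  If a point of the support is not too close to some \<open>b \<in> B\<close>, then neither is the new point as far
  as paths through that point are concerned, because its distance to \<open>z\<close> is bounded by the path through
  the same point. So the exceptional \<open>b\<close> for the new point are exceptional for some support point, and
  fewer than \<open>|B|\<close> sets of fewer than \<open>|B|\<close> exceptions do not exhaust a regular cardinal. A part \<open>Z1\<close> of
  the support that is too large for this argument is left to the caller.
\<close>

lemma (in nonempty_type) free_dist_marker:
  assumes mk: "marker M d z B" and B: "stable |B|" "infinite B"
    and Z: "Z = Z0 \<union> Z1" and Z0: "|Z0| <o |B|"
    and Z1: "|{b \<in> B. \<exists>(s, r)\<in>Z1. r + d s b < 2 + min 1 (free_dist d Z z)}| <o |B|"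
  shows "|{b \<in> B. free_dist d Z b < 2 + min 1 (free_dist d Z z)}| <o |B|"
proof -
  let ?F = "free_dist d Z"
  let ?V = "\<lambda>p. {b \<in> B. d (fst p) b < 2 + min 1 (d (fst p) z)}"
  have "|?V p| <o |B|" if "p \<in> Z0" for p
    using mk in_M[of "fst p" "snd p"] that Z by (auto simp: marker_def)
  then have "|\<Union>p\<in>Z0. ?V p| <o |B|"
    by (rule stable_UNION[OF B(1) Z0])
  moreover have "{b \<in> B. ?F b < 2 + min 1 (?F z)} \<subseteq>
      (\<Union>p\<in>Z0. ?V p) \<union> {b \<in> B. \<exists>(s, r)\<in>Z1. r + d s b < 2 + min 1 (?F z)}"
  proof
    fix b assume "b \<in> {b \<in> B. ?F b < 2 + min 1 (?F z)}"
    then have b: "b \<in> B" "?F b < 2 + min 1 (?F z)" by auto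
    obtain s r where s: "(s, r) \<in> Z" "r + d s b < 2 + min 1 (?F z)"
      using b(2) free_dist_less by blast
    moreover have "?F z \<le> r + d s z" "0 \<le> r"
      using s(1) free_dist_le type_nonneg by auto
    ultimately have "d s b < 2 + min 1 (d s z)" by linarith
    then show "b \<in> (\<Union>p\<in>Z0. ?V p) \<union> {b \<in> B. \<exists>(s, r)\<in>Z1. r + d s b < 2 + min 1 (?F z)}"
      using s b(1) Z by force
  qed
  ultimately show ?thesis
    using ordLess_subset ordLess_Un[OF B(2)] Z1 by blast
qed

section \<open>Spaces with markers\<close>

text \<open>
  The pairs in \<open>marks\<close> are points with one of their markers.
\<close>

record 'a stage =
  pts :: "'a set"
  dst :: "'a \<Rightarrow> 'a \<Rightarrow> real"
  marks :: "('a \<times> 'a set) set"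

text \<open>
  The bound on the union of the smaller markers lets one avoid all of them at once. The last condition says
  that the cardinality of a marker determines the point, though a point may have several markers.
\<close>

definition valid_stage :: "'k rel \<Rightarrow> 'a stage \<Rightarrow> bool" where
  "valid_stage \<kappa> P \<longleftrightarrow> Metric_space (pts P) (dst P) \<and>
     (\<forall>(x, A)\<in>marks P. marker (pts P) (dst P) x A \<and> \<kappa> <o |A| \<and> stable |A| \<and>
        |\<Union>{B. |B| <o |A| \<and> (\<exists>z. (z, B) \<in> marks P)}| <o |A| ) \<and>
     (\<forall>(x, A)\<in>marks P. \<forall>(z, B)\<in>marks P. |A| =o |B| \<longrightarrow> x = z)"

text \<open>
  New markers have to be larger than the whole old space. Thus markers smaller than an old one are old
  themselves, which is why the conditions of validity pass to unions of chains.
\<close>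

definition extends :: "'a stage \<Rightarrow> 'a stage \<Rightarrow> bool" where
  "extends P Q \<longleftrightarrow> pts P \<subseteq> pts Q \<and> (\<forall>x\<in>pts P. \<forall>y\<in>pts P. dst Q x y = dst P x y) \<and>
     marks P \<subseteq> marks Q \<and> (\<forall>(x, A)\<in>marks Q - marks P. |pts P| <o |A| )"

lemma valid_stage_metric: "valid_stage \<kappa> P \<Longrightarrow> Metric_space (pts P) (dst P)"
  by (simp add: valid_stage_def)

lemma valid_stage_marker:
  assumes "valid_stage \<kappa> P" "(x, A) \<in> marks P"
  shows "marker (pts P) (dst P) x A" "\<kappa> <o |A|" "stable |A|"
    "|\<Union>{B. |B| <o |A| \<and> (\<exists>z. (z, B) \<in> marks P)}| <o |A|"
  using assms by (auto simp: valid_stage_def)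

lemma valid_stageI:
  assumes "Metric_space (pts P) (dst P)"
    and "\<And>x A. (x, A) \<in> marks P \<Longrightarrow> marker (pts P) (dst P) x A"
    and "\<And>x A. (x, A) \<in> marks P \<Longrightarrow> \<kappa> <o |A| \<and> stable |A|"
    and "\<And>x A. (x, A) \<in> marks P \<Longrightarrow> |\<Union>{B. |B| <o |A| \<and> (\<exists>z. (z, B) \<in> marks P)}| <o |A|"
    and "\<And>x A z B. \<lbrakk>(x, A) \<in> marks P; (z, B) \<in> marks P; |A| =o |B| \<rbrakk> \<Longrightarrow> x = z"
  shows "valid_stage \<kappa> P"
  unfolding valid_stage_def using assms by blast

lemma valid_stage_inj:
  "\<lbrakk>valid_stage \<kappa> P; (x, A) \<in> marks P; (z, B) \<in> marks P; |A| =o |B| \<rbrakk> \<Longrightarrow> x = z"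
  unfolding valid_stage_def by blast

lemma extendsD:
  assumes "extends P Q"
  shows "pts P \<subseteq> pts Q" "\<And>x y. \<lbrakk>x \<in> pts P; y \<in> pts P\<rbrakk> \<Longrightarrow> dst Q x y = dst P x y"
    "marks P \<subseteq> marks Q" "\<And>x A. \<lbrakk>(x, A) \<in> marks Q; (x, A) \<notin> marks P\<rbrakk> \<Longrightarrow> |pts P| <o |A|"
  using assms by (auto simp: extends_def)

lemma extends_refl: "extends P P"
  by (simp add: extends_def)

lemma extends_trans:
  assumes PQ: "extends P Q" and QR: "extends Q R"
  shows "extends P R"
  unfolding extends_def
proof (intro conjI ballI)
  note p = extendsD[OF PQ] note q = extendsD[OF QR]
  show "pts P \<subseteq> pts R" "marks P \<subseteq> marks R" using p q by auto
  show "dst R x y = dst P x y" if "x \<in> pts P" "y \<in> pts P" for x y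
    using that p(1) p(2)[OF that] q(2)[of x y] by auto
  fix m assume m: "m \<in> marks R - marks P"
  obtain x A where [simp]: "m = (x, A)" by force
  show "case m of (x, A) \<Rightarrow> |pts P| <o |A|"
  proof (cases "m \<in> marks Q")
    case True then show ?thesis using m p(4)[of x A] by simp
  next
    case False
    then have "|pts Q| <o |A|" using m q(4)[of x A] by simp
    then show ?thesis using ordLess_subset[OF p(1)] by simp
  qed
qed

text \<open>
  The value \<open>0\<close> outside the union keeps the distance function symmetric and nonnegative everywhere, as
  \<^locale>\<open>Metric_space\<close> demands.
\<close>

definition Sup_stage :: "'a stage set \<Rightarrow> 'a stage" where
  "Sup_stage C = \<lparr>pts = (\<Union>P\<in>C. pts P),
     dst = (\<lambda>x y. if \<exists>P\<in>C. x \<in> pts P \<and> y \<in> pts P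
                  then dst (SOME P. P \<in> C \<and> x \<in> pts P \<and> y \<in> pts P) x y else 0),
     marks = (\<Union>P\<in>C. marks P)\<rparr>"

context
  fixes C :: "'a stage set" and \<kappa> :: "'k rel"
  assumes chain: "\<And>P Q. \<lbrakk>P \<in> C; Q \<in> C\<rbrakk> \<Longrightarrow> extends P Q \<or> extends Q P"
    and valid: "\<And>P. P \<in> C \<Longrightarrow> valid_stage \<kappa> P"
begin

lemma chain_common:
  assumes "P \<in> C" "Q \<in> C" obtains R where "R \<in> C" "extends P R" "extends Q R"
  using chain[OF assms] assms extends_refl by blast

lemma dst_Sup_stage:
  assumes P: "P \<in> C" "x \<in> pts P" "y \<in> pts P"
  shows "dst (Sup_stage C) x y = dst P x y"
proof -
  let ?Q = "SOME P. P \<in> C \<and> x \<in> pts P \<and> y \<in> pts P"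
  have Q: "?Q \<in> C \<and> x \<in> pts ?Q \<and> y \<in> pts ?Q"
    by (rule someI_ex) (use P in blast)
  then have "dst ?Q x y = dst P x y"
    using chain[of ?Q P] P extendsD(2)[of ?Q P x y] extendsD(2)[of P ?Q x y] by auto
  then show ?thesis using P by (auto simp: Sup_stage_def)
qed

lemma extends_Sup_stage:
  assumes P: "P \<in> C" shows "extends P (Sup_stage C)"
  unfolding extends_def
proof (intro conjI ballI)
  show "pts P \<subseteq> pts (Sup_stage C)" "marks P \<subseteq> marks (Sup_stage C)"
    using P by (auto simp: Sup_stage_def)
  show "dst (Sup_stage C) x y = dst P x y" if "x \<in> pts P" "y \<in> pts P" for x y
    by (rule dst_Sup_stage[OF P that])
  fix m assume m: "m \<in> marks (Sup_stage C) - marks P"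
  obtain x A where [simp]: "m = (x, A)" by force
  obtain Q where Q: "Q \<in> C" "(x, A) \<in> marks Q" "(x, A) \<notin> marks P"
    using m by (auto simp: Sup_stage_def)
  then have "extends P Q" using chain[OF P Q(1)] extendsD(3)[of Q P] by auto
  then show "case m of (x, A) \<Rightarrow> |pts P| <o |A|" using extendsD(4) Q by auto
qed

lemma Sup_stage_points:
  assumes "x \<in> pts (Sup_stage C)" "y \<in> pts (Sup_stage C)"
  obtains R where "R \<in> C" "x \<in> pts R" "y \<in> pts R"
proof -
  obtain P Q where PQ: "P \<in> C" "x \<in> pts P" "Q \<in> C" "y \<in> pts Q"
    using assms by (auto simp: Sup_stage_def)
  obtain R where R: "R \<in> C" "extends P R" "extends Q R"
    by (rule chain_common[OF PQ(1,3)])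
  show ?thesis
    by (rule that[OF R(1)]) (use PQ extendsD(1)[OF R(2)] extendsD(1)[OF R(3)] in auto)
qed

lemma valid_Sup_stage: "valid_stage \<kappa> (Sup_stage C)"
proof -
  let ?S = "Sup_stage C"
  have dS: "dst ?S x y = dst P x y" if "P \<in> C" "x \<in> pts P" "y \<in> pts P" for P x y
    using dst_Sup_stage that .
  have MS: "Metric_space (pts P) (dst P)" if "P \<in> C" for P
    using valid[OF that] by (rule valid_stage_metric)
  have metric: "Metric_space (pts ?S) (dst ?S)"
  proof
    fix x y
    have *: "0 \<le> dst ?S x y \<and> dst ?S x y = dst ?S y x" if P: "P \<in> C" "x \<in> pts P" "y \<in> pts P" for P
      using dS[OF P] dS[OF P(1,3,2)] Metric_space.nonneg[OF MS[OF P(1)]]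
        Metric_space.commute[OF MS[OF P(1)], of x y] by simp
    show "0 \<le> dst ?S x y"
      using * by (cases "\<exists>P\<in>C. x \<in> pts P \<and> y \<in> pts P") (auto simp: Sup_stage_def)
    show "dst ?S x y = dst ?S y x"
    proof (cases "\<exists>P\<in>C. x \<in> pts P \<and> y \<in> pts P")
      case False
      then show ?thesis by (auto simp: Sup_stage_def)
    qed (use * in blast)
  next
    fix x y assume "x \<in> pts ?S" "y \<in> pts ?S"
    then obtain R where R: "R \<in> C" "x \<in> pts R" "y \<in> pts R" by (rule Sup_stage_points)
    then show "dst ?S x y = 0 \<longleftrightarrow> x = y"
      using Metric_space.zero[OF MS[OF R(1)]] dS by simp
  next
    fix x y z assume xyz: "x \<in> pts ?S" "y \<in> pts ?S" "z \<in> pts ?S"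
    obtain R where R: "R \<in> C" "x \<in> pts R" "y \<in> pts R"
      using Sup_stage_points xyz by blast
    obtain R' where R': "R' \<in> C" "z \<in> pts R'"
      using Sup_stage_points xyz by blast
    obtain Q where "Q \<in> C" "extends R Q" "extends R' Q"
      using chain_common R R' by blast
    then have "Q \<in> C" "x \<in> pts Q" "y \<in> pts Q" "z \<in> pts Q"
      using R R' extendsD(1) by blast+
    then show "dst ?S x z \<le> dst ?S x y + dst ?S y z"
      using Metric_space.triangle[OF MS] dS by simp
  qed
  have *: "marker (pts ?S) (dst ?S) x A \<and> \<kappa> <o |A| \<and> stable |A| \<and>
        |\<Union>{B. |B| <o |A| \<and> (\<exists>z. (z, B) \<in> marks ?S)}| <o |A|" if "(x, A) \<in> marks ?S" for x A
  proof -
    obtain P where P: "P \<in> C" "(x, A) \<in> marks P"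
      using \<open>(x, A) \<in> marks ?S\<close> by (auto simp: Sup_stage_def)
    note v = valid_stage_marker[OF valid[OF P(1)] P(2)]
    have A: "x \<in> pts P" "A \<subseteq> pts P" "\<And>a. a \<in> A \<Longrightarrow> dst P x a = 2"
      using v(1) by (auto simp: marker_def)
    have "marker (pts ?S) (dst ?S) x A"
      unfolding marker_def
    proof (intro conjI ballI)
      show "x \<in> pts ?S" "A \<subseteq> pts ?S" using A P(1) by (auto simp: Sup_stage_def)
      show "dst ?S x a = 2" if "a \<in> A" for a
        using A(3)[OF that] dS[OF P(1) A(1)] A(2) that by auto
      fix y assume "y \<in> pts ?S"
      then obtain Q where Q: "Q \<in> C" "y \<in> pts Q" by (auto simp: Sup_stage_def)
      obtain R where R: "R \<in> C" "extends P R" "extends Q R"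
        using chain_common P(1) Q(1) by blast
      have "(x, A) \<in> marks R" "y \<in> pts R" "x \<in> pts R" "A \<subseteq> pts R"
        using P(2) Q(2) A extendsD[OF R(2)] extendsD[OF R(3)] by auto
      moreover have "marker (pts R) (dst R) x A"
        using valid_stage_marker(1)[OF valid[OF R(1)]] calculation(1) .
      moreover have "{a \<in> A. dst ?S y a < 2 + min 1 (dst ?S y x)} =
          {a \<in> A. dst R y a < 2 + min 1 (dst R y x)}"
        using dS[OF R(1)] calculation by auto
      ultimately show "|{a \<in> A. dst ?S y a < 2 + min 1 (dst ?S y x)}| <o |A|"
        by (simp add: marker_def)
    qed
    moreover have "{B. |B| <o |A| \<and> (\<exists>z. (z, B) \<in> marks ?S)} \<subseteq>
        {B. |B| <o |A| \<and> (\<exists>z. (z, B) \<in> marks P)}"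
    proof clarify
      fix B z assume B: "|B| <o |A|" "(z, B) \<in> marks ?S"
      have "\<not> |pts P| <o |B|"
        using B(1) A(2) by (meson card_of_mono1 not_ordLess_ordLeq ordLess_transitive)
      then show "\<exists>z. (z, B) \<in> marks P"
        using extendsD(4)[OF extends_Sup_stage[OF P(1)] B(2)] by blast
    qed
    then have "|\<Union>{B. |B| <o |A| \<and> (\<exists>z. (z, B) \<in> marks ?S)}| <o |A|"
      using ordLess_subset[OF Union_mono v(4)] by blast
    ultimately show ?thesis using v by blast
  qed
  have "x = z" if m: "(x, A) \<in> marks ?S" "(z, B) \<in> marks ?S" "|A| =o |B|" for x z A B
  proof -
    obtain P Q where "P \<in> C" "(x, A) \<in> marks P" "Q \<in> C" "(z, B) \<in> marks Q"
      using m by (auto simp: Sup_stage_def)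
    then obtain R where "R \<in> C" "(x, A) \<in> marks R" "(z, B) \<in> marks R"
      using chain_common[of P Q] extendsD(3) by (metis subsetD)
    then show ?thesis using valid_stage_inj[OF valid _ _ m(3)] by blast
  qed
  with metric * show ?thesis unfolding valid_stage_def by blast
qed

end

definition add_points ::
    "'a stage \<Rightarrow> 'a set \<Rightarrow> ('a \<Rightarrow> real) \<Rightarrow> real \<Rightarrow> ('a \<times> 'a set) set \<Rightarrow> 'a stage" where
  "add_points P N F c T =
     \<lparr>pts = pts P \<union> N, dst = extend_dist (pts P) (dst P) N F c, marks = marks P \<union> T\<rparr>"

lemma extends_add_points:
  assumes "\<And>x A. (x, A) \<in> T \<Longrightarrow> |pts P| <o |A|"
  shows "extends P (add_points P N F c T)"
proof -
  have "\<forall>(x, A)\<in>T - marks P. |pts P| <o |A|" using assms by blast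
  then show ?thesis by (simp add: extends_def add_points_def extend_dist_def Un_Diff)
qed

text \<open>
  For an old marker only the new points have to be examined, and they all have the distances \<open>F\<close>.
\<close>

lemma marker_extend_dist:
  assumes mk: "marker M d z B" and disj: "M \<inter> N = {}"
    and few: "|{b \<in> B. F b < 2 + min 1 (F z)}| <o |B|"
  shows "marker (M \<union> N) (extend_dist M d N F c) z B"
proof -
  let ?e = "extend_dist M d N F c"
  have z: "z \<in> M" "B \<subseteq> M" using mk by (auto simp: marker_def)
  have eM: "?e x y = d x y" if "x \<in> M" "y \<in> M" for x y
    using that by (simp add: extend_dist_def)
  have eN: "?e n y = F y" if "n \<in> N" "y \<in> M" for n y
    using that disj by (auto simp: extend_dist_def)
  have "|{b \<in> B. ?e y b < 2 + min 1 (?e y z)}| <o |B|" if "y \<in> M \<union> N" for y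
    using that
  proof
    assume y: "y \<in> M"
    have "{b \<in> B. ?e y b < 2 + min 1 (?e y z)} = {b \<in> B. d y b < 2 + min 1 (d y z)}"
      using y z eM by auto
    then show ?thesis using mk y by (simp add: marker_def)
  next
    assume y: "y \<in> N"
    have "{b \<in> B. ?e y b < 2 + min 1 (?e y z)} = {b \<in> B. F b < 2 + min 1 (F z)}"
      using y z eN by auto
    then show ?thesis using few by simp
  qed
  moreover have "?e z a = 2" if "a \<in> B" for a
    using mk z eM[of z a] that by (auto simp: marker_def)
  ultimately show ?thesis using z unfolding marker_def by blast
qed

lemma valid_add_point:
  assumes P: "valid_stage \<kappa> P" and p: "p \<notin> pts P"
    and F: "katetov (pts P) (dst P) F" "\<And>w. w \<in> pts P \<Longrightarrow> 0 < F w"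
    and few: "\<And>z B. (z, B) \<in> marks P \<Longrightarrow> |{b \<in> B. F b < 2 + min 1 (F z)}| <o |B|"
  shows "valid_stage \<kappa> (add_points P {p} F 1 {})"
proof -
  have "Metric_space (pts P \<union> {p}) (extend_dist (pts P) (dst P) {p} F 1)"
    by (rule Metric_space_extend_dist[OF valid_stage_metric[OF P] _ F]) (use p in auto)
  moreover have "marker (pts P \<union> {p}) (extend_dist (pts P) (dst P) {p} F 1) z B"
    if "(z, B) \<in> marks P" for z B
    by (rule marker_extend_dist[OF valid_stage_marker(1)[OF P that] _ few[OF that]]) (use p in auto)
  moreover have "marks (add_points P {p} F 1 {}) = marks P"
    by (simp add: add_points_def)
  ultimately show ?thesis
    using valid_stage_marker(2-4)[OF P] valid_stage_inj[OF P]
    by (intro valid_stageI) (simp_all only: add_points_def stage.simps simp_thms)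
qed

text \<open>
  New points attached freely to \<open>x\<close> at distance \<open>2\<close>, hence at distance \<open>4\<close> from each other, form a
  marker of \<open>x\<close>: an old point has distance exactly \<open>2 + d y x\<close> from all of them, and a new one is an
  exception only for itself.
\<close>

lemma valid_add_marker:
  assumes P: "valid_stage \<kappa> P" and x: "x \<in> pts P" and N: "N \<inter> pts P = {}"
    and card: "\<kappa> <o |N|" "stable |N|" "infinite N" "|pts P| <o |N|"
    and few: "\<And>z B. (z, B) \<in> marks P \<Longrightarrow>
      |{b \<in> B. 2 + dst P x b < 2 + min 1 (2 + dst P x z)}| <o |B|"
  shows "valid_stage \<kappa> (add_points P N (\<lambda>w. 2 + dst P x w) 4 {(x, N)})"
proof -
  interpret Metric_space "pts P" "dst P" by (rule valid_stage_metric[OF P])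
  let ?F = "\<lambda>w. 2 + dst P x w"
  let ?M = "pts P \<union> N" and ?e = "extend_dist (pts P) (dst P) N ?F 4"
  have disj: "pts P \<inter> N = {}" using N by auto
  have pos: "0 < ?F w" for w using nonneg[of x w] by linarith
  have kat: "katetov (pts P) (dst P) ?F"
    unfolding katetov_def
  proof (intro ballI conjI)
    fix u v assume "u \<in> pts P" "v \<in> pts P"
    then show "?F u \<le> ?F v + dst P u v" "dst P u v \<le> ?F u + ?F v"
      using triangle[of x v u] triangle[of u x v] x by (simp_all add: commute)
  qed
  have metric: "Metric_space ?M ?e"
    by (rule Metric_space_extend_dist[OF valid_stage_metric[OF P] disj kat pos]) auto
  have old: "marker ?M ?e z B" if "(z, B) \<in> marks P" for z B
    by (rule marker_extend_dist[OF valid_stage_marker(1)[OF P that] disj few[OF that]])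
  have new: "marker ?M ?e x N"
    unfolding marker_def
  proof (intro conjI ballI)
    show "x \<in> ?M" "N \<subseteq> ?M" using x by auto
    show "?e x a = 2" if "a \<in> N" for a
      using that x disj by (auto simp: extend_dist_def)
    fix y assume "y \<in> ?M"
    have "{a \<in> N. ?e y a < 2 + min 1 (?e y x)} \<subseteq> {y}"
    proof clarify
      fix a assume a: "a \<in> N" "?e y a < 2 + min 1 (?e y x)"
      show "a = y"
      proof (cases "y \<in> pts P")
        case True
        then have "?e y a = 2 + dst P y x" "?e y x = dst P y x"
          using a(1) x disj by (auto simp: extend_dist_def commute)
        with a(2) show ?thesis by linarith
      next
        case False
        then have "?e y a = 4" if "a \<noteq> y"
          using a(1) that \<open>y \<in> ?M\<close> disj by (auto simp: extend_dist_def)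
        with a(2) show ?thesis by (smt (verit))
      qed
    qed
    moreover have "|{y}| <o |N|"
      using card(3) by (intro finite_ordLess_infinite card_of_Well_order) (simp_all add: Field_card_of)
    ultimately show "|{a \<in> N. ?e y a < 2 + min 1 (?e y x)}| <o |N|"
      by (rule ordLess_subset)
  qed
  have le: "|B| <o |N|" if "(z, B) \<in> marks P" for z B
    using ordLess_subset[OF marker_subset[OF valid_stage_marker(1)[OF P that]] card(4)] .
  have newU: "|\<Union>{B. |B| <o |N| \<and> (\<exists>z. (z, B) \<in> marks P \<union> {(x, N)})}| <o |N|"
  proof (rule ordLess_subset[OF _ card(4)])
    show "\<Union>{B. |B| <o |N| \<and> (\<exists>z. (z, B) \<in> marks P \<union> {(x, N)})} \<subseteq> pts P"
    proof clarify
      fix b B z assume "b \<in> B" "|B| <o |N|" "(z, B) \<in> marks P \<union> {(x, N)}"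
      then have "(z, B) \<in> marks P" using ordLess_irreflexive by blast
      then show "b \<in> pts P"
        using marker_subset[OF valid_stage_marker(1)[OF P]] \<open>b \<in> B\<close> by blast
    qed
  qed
  have oldU: "|\<Union>{B. |B| <o |A| \<and> (\<exists>z. (z, B) \<in> marks P \<union> {(x, N)})}| <o |A|"
    if A: "(z, A) \<in> marks P" for z A
  proof -
    have "\<not> |N| <o |A|" using le[OF A] ordLess_transitive ordLess_irreflexive by blast
    then have "{B. |B| <o |A| \<and> (\<exists>z. (z, B) \<in> marks P \<union> {(x, N)})} =
        {B. |B| <o |A| \<and> (\<exists>z. (z, B) \<in> marks P)}" by auto
    then show ?thesis using valid_stage_marker(4)[OF P A] by simp
  qed
  have neq: "\<not> |B| =o |N|" "\<not> |N| =o |B|" if "(z, B) \<in> marks P" for z B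
    using le[OF that] not_ordLess_ordIso ordIso_symmetric by blast+
  let ?Q = "add_points P N ?F 4 {(x, N)}"
  have Q: "pts ?Q = ?M" "dst ?Q = ?e" "marks ?Q = marks P \<union> {(x, N)}"
    by (simp_all add: add_points_def)
  show ?thesis
  proof (rule valid_stageI; unfold Q)
    show "Metric_space ?M ?e" by (rule metric)
    fix y A assume "(y, A) \<in> marks P \<union> {(x, N)}"
    then have yA: "(y, A) \<in> marks P \<or> y = x \<and> A = N" by auto
    show "marker ?M ?e y A"
      using yA by (elim disjE conjE) (use old new in simp_all)
    show "\<kappa> <o |A| \<and> stable |A|"
      using yA by (elim disjE conjE) (use valid_stage_marker(2,3)[OF P] card in simp_all)
    show "|\<Union>{B. |B| <o |A| \<and> (\<exists>z. (z, B) \<in> marks P \<union> {(x, N)})}| <o |A|"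
      using yA by (elim disjE conjE) (use oldU newU in simp_all)
    fix z B assume "(z, B) \<in> marks P \<union> {(x, N)}" and eq: "|A| =o |B|"
    then have zB: "(z, B) \<in> marks P \<or> z = x \<and> B = N" by auto
    show "y = z"
      using yA zB eq neq valid_stage_inj[OF P _ _ eq] by (elim disjE conjE) simp_all
  qed
qed

section \<open>Adding points below an inaccessible cardinal\<close>

definition realized :: "'a stage \<Rightarrow> ('a \<times> real) set \<Rightarrow> bool" where
  "realized Q Z \<longleftrightarrow> (\<exists>p\<in>pts Q. \<forall>(s, r)\<in>Z. s \<in> pts Q \<and> dst Q p s = r)"

text \<open>
  The negation of the uniqueness that the point of a marker enjoys: \<open>y\<close> is not the only point
  within distance \<open>2\<close> of \<open>|A|\<close> many elements of \<open>A\<close>.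
\<close>

definition spoiled :: "'a stage \<Rightarrow> 'a \<Rightarrow> 'a set \<Rightarrow> bool" where
  "spoiled Q y A \<longleftrightarrow> A \<subseteq> pts Q \<and> (\<exists>p\<in>pts Q. p \<noteq> y \<and> \<not> |{a \<in> A. dst Q p a \<le> 2}| <o |A| )"

lemma realized_mono:
  assumes ext: "extends P Q" and "realized P Z" shows "realized Q Z"
proof -
  obtain p where p: "p \<in> pts P" "\<forall>(s, r)\<in>Z. s \<in> pts P \<and> dst P p s = r"
    using assms(2) by (auto simp: realized_def)
  have "s \<in> pts Q \<and> dst Q p s = r" if "(s, r) \<in> Z" for s r
    using extendsD(1)[OF ext] extendsD(2)[OF ext p(1), of s] p(2) that by auto
  then show ?thesis using p(1) extendsD(1)[OF ext] unfolding realized_def by blast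
qed

lemma spoiled_mono:
  assumes ext: "extends P Q" and "spoiled P y A" shows "spoiled Q y A"
proof -
  obtain p where A: "A \<subseteq> pts P" and p: "p \<in> pts P" "p \<noteq> y" "\<not> |{a \<in> A. dst P p a \<le> 2}| <o |A|"
    using assms(2) unfolding spoiled_def by blast
  have "{a \<in> A. dst Q p a \<le> 2} = {a \<in> A. dst P p a \<le> 2}"
    using extendsD(2)[OF ext p(1)] A by auto
  then have "\<not> |{a \<in> A. dst Q p a \<le> 2}| <o |A|" using p(3) by simp
  moreover have "A \<subseteq> pts Q" "p \<in> pts Q" using A p(1) extendsD(1)[OF ext] by auto
  ultimately show ?thesis using p(2) unfolding spoiled_def by blast
qed

locale below_inaccessible =
  fixes \<kappa> :: "'k rel" and \<theta> :: "'l rel"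
  assumes \<kappa>: "Card_order \<kappa>" "natLeq <o \<kappa>"
    and \<theta>: "strongly_inaccessible \<theta>"
    and \<kappa>_less: "\<kappa> <o \<theta>"
begin

lemma card_\<theta>: "Card_order \<theta>" and regular_\<theta>: "regularCard \<theta>" and natLeq_\<theta>: "natLeq <o \<theta>"
  using \<theta> by (simp_all add: strongly_inaccessible_def)

lemma infinite_\<theta>: "infinite (Field \<theta>)"
proof -
  have "natLeq \<le>o |Field \<theta>|"
    by (rule ordLeq_ordIso_trans[OF ordLess_imp_ordLeq[OF natLeq_\<theta>]
          ordIso_symmetric[OF card_of_Field_ordIso[OF card_\<theta>]]])
  then show ?thesis using infinite_iff_natLeq_ordLeq by blast
qed

lemma stable_\<theta>: "stable \<theta>"
  by (rule regularCard_stable[OF card_\<theta> infinite_\<theta> regular_\<theta>])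

lemma Un_less_\<theta>: "\<lbrakk> |A| <o \<theta>; |B| <o \<theta> \<rbrakk> \<Longrightarrow> |A \<union> B| <o \<theta>"
  by (rule card_of_Un_ordLess_infinite_Field[OF infinite_\<theta> card_\<theta>])

lemma finite_less_\<theta>: "finite A \<Longrightarrow> |A| <o \<theta>"
  using ordLess_transitive[OF _ natLeq_\<theta>] finite_iff_ordLess_natLeq by fast

lemma Pow_less_\<theta>:
  assumes "|A| <o \<theta>" shows "|Pow A| <o \<theta>"
proof -
  have "|Pow A| =o ctwo ^c |A|"
    using card_of_Pow_Func[of A] by (simp add: cexp_def ctwo_def Field_card_of)
  also have "ctwo ^c |A| <o \<theta>"
    by (rule strongly_inaccessibleD[OF \<theta> card_of_Card_order assms])
  finally show ?thesis .
qed

lemma infinite_above_\<kappa>: "\<kappa> <o |A| \<Longrightarrow> infinite A"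
  using ordLess_imp_ordLeq[OF ordLess_transitive[OF \<kappa>(2)]] infinite_iff_natLeq_ordLeq by fast

lemma fresh_copy:
  fixes X :: "'b set"
  assumes A: "|A| <o \<theta>" and X: "|X| \<le>o \<theta>"
  obtains N where "N \<subseteq> Field \<theta>" "N \<inter> A = {}" "|X| =o |N|"
proof -
  have "\<not> |Field \<theta> - A| <o \<theta>"
  proof
    assume "|Field \<theta> - A| <o \<theta>"
    from Un_less_\<theta>[OF this A] have "|Field \<theta>| <o \<theta>" by (rule ordLess_subset[rotated]) auto
    then show False using not_ordLess_ordIso card_of_Field_ordIso[OF card_\<theta>] by fast
  qed
  then have "\<theta> \<le>o |Field \<theta> - A|"
    using ordLess_or_ordLeq[OF card_of_Well_order card_order_on_well_order_on[OF card_\<theta>]] by fast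
  from ordLeq_transitive[OF X this] have "|X| \<le>o |Field \<theta> - A|" .
  then obtain f where f: "inj_on f X" "f ` X \<subseteq> Field \<theta> - A"
    by (metis card_of_ordLeq)
  then have "|X| =o |f ` X|" using card_of_ordIsoI inj_on_imp_bij_betw by blast
  then show ?thesis using that[of "f ` X"] f(2) by blast
qed

lemma fresh_point:
  assumes "|A| <o \<theta>" obtains p where "p \<in> Field \<theta>" "p \<notin> A"
proof -
  have "|{()}| \<le>o \<theta>" by (rule ordLess_imp_ordLeq[OF finite_less_\<theta>]) simp
  then obtain N where N: "N \<subseteq> Field \<theta>" "N \<inter> A = {}" "|{()}| =o |N|"
    using fresh_copy[OF assms] by blast
  have "N \<noteq> {}" using card_of_empty2[of "{()}"] N(3) by auto
  then show ?thesis using that N(1,2) by blast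
qed

text \<open>
  Successor cardinals supply the regular cardinalities of markers; they stay below \<open>\<theta>\<close> because it
  is a strong limit.
\<close>

lemma fresh_successor:
  fixes A :: "'l set"
  assumes A: "|A| <o \<theta>"
  obtains N where "N \<subseteq> Field \<theta>" "N \<inter> A = {}" "|N| <o \<theta>" "\<kappa> <o |N|" "|A| <o |N|" "stable |N|"
proof -
  define B where "B = A <+> Field \<kappa>"
  let ?s = "cardSuc |B|"
  have \<kappa>iso: "\<kappa> =o |Field \<kappa>|" by (rule ordIso_symmetric[OF card_of_Field_ordIso[OF \<kappa>(1)]])
  have F\<kappa>: "|Field \<kappa>| <o \<theta>"
    by (rule ordIso_ordLess_trans[OF card_of_Field_ordIso[OF \<kappa>(1)] \<kappa>_less])
  have "infinite (Field \<kappa>)"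
    using ordLeq_ordIso_trans[OF ordLess_imp_ordLeq[OF \<kappa>(2)] \<kappa>iso] infinite_iff_natLeq_ordLeq by fast
  then have infB: "infinite B" by (simp add: B_def)
  have B: "|B| <o \<theta>"
    unfolding B_def by (rule card_of_Plus_ordLess_infinite_Field[OF infinite_\<theta> card_\<theta> A F\<kappa>])
  have s: "Card_order ?s" "|B| <o ?s"
    by (simp_all add: cardSuc_Card_order cardSuc_greater card_of_Card_order)
  have "?s \<le>o |Pow B|"
    by (rule cardSuc_least[OF card_of_Card_order card_of_Card_order card_of_Pow])
  from ordLeq_ordLess_trans[OF this Pow_less_\<theta>[OF B]] have s\<theta>: "?s <o \<theta>" .
  have iso: "|Field ?s| =o ?s" by (rule card_of_Field_ordIso[OF s(1)])
  have "|Field ?s| \<le>o \<theta>"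
    by (rule ordLess_imp_ordLeq[OF ordIso_ordLess_trans[OF iso s\<theta>]])
  then obtain N where N: "N \<subseteq> Field \<theta>" "N \<inter> A = {}" "|Field ?s| =o |N|"
    by (rule fresh_copy[OF A])
  have sN: "?s =o |N|" by (rule ordIso_transitive[OF ordIso_symmetric[OF iso] N(3)])
  have infs: "infinite (Field ?s)"
    using infB cardSuc_finite[OF card_of_Card_order, of B] by (simp add: Field_card_of)
  have "regularCard ?s"
    by (rule infinite_cardSuc_regularCard[OF _ card_of_Card_order]) (simp add: Field_card_of infB)
  then have "stable ?s" by (rule regularCard_stable[OF s(1) infs])
  then have st: "stable |N|" by (rule stable_ordIso1[OF _ ordIso_symmetric[OF sN]])
  have BN: "|B| <o |N|" by (rule ordLess_ordIso_trans[OF s(2) sN])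
  show ?thesis
  proof (rule that[OF N(1,2) _ _ _ st])
    show "|N| <o \<theta>" by (rule ordIso_ordLess_trans[OF ordIso_symmetric[OF sN] s\<theta>])
    show "|A| <o |N|"
      using ordLeq_ordLess_trans[OF card_of_Plus1 BN[unfolded B_def]] .
    show "\<kappa> <o |N|"
      using ordIso_ordLess_trans[OF \<kappa>iso ordLeq_ordLess_trans[OF card_of_Plus2 BN[unfolded B_def]]] .
  qed
qed

definition small_stage :: "'l stage \<Rightarrow> bool" where
  "small_stage P \<longleftrightarrow> valid_stage \<kappa> P \<and> pts P \<subseteq> Field \<theta> \<and> |pts P| <o \<theta>"

lemma small_stageD:
  assumes "small_stage P"
  shows "valid_stage \<kappa> P" "pts P \<subseteq> Field \<theta>" "|pts P| <o \<theta>" "Metric_space (pts P) (dst P)"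
  using assms valid_stage_metric by (auto simp: small_stage_def)

lemma add_free_point:
  assumes P: "small_stage P" and Z: "nonempty_type (pts P) (dst P) Z"
    and pos: "\<And>w. w \<in> pts P \<Longrightarrow> free_dist (dst P) Z w \<noteq> 0"
    and few: "\<And>z B. (z, B) \<in> marks P \<Longrightarrow>
      |{b \<in> B. free_dist (dst P) Z b < 2 + min 1 (free_dist (dst P) Z z)}| <o |B|"
  obtains Q p where "small_stage Q" "extends P Q" "p \<in> pts Q" "p \<notin> pts P"
    "\<forall>(s, r)\<in>Z. s \<in> pts Q \<and> dst Q p s = r"
proof -
  interpret nonempty_type "pts P" "dst P" Z by (rule Z)
  let ?F = "free_dist (dst P) Z"
  note P' = small_stageD[OF P]
  obtain p where p: "p \<in> Field \<theta>" "p \<notin> pts P"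
    using fresh_point[OF P'(3)] by blast
  define Q where "Q = add_points P {p} ?F 1 {}"
  have "0 \<le> ?F w" for w
    by (rule free_dist_greatest) (auto intro: add_nonneg_nonneg type_nonneg)
  then have pos': "0 < ?F w" if "w \<in> pts P" for w
    using pos[OF that] by (simp add: order_less_le)
  have "valid_stage \<kappa> Q"
    unfolding Q_def by (rule valid_add_point[OF P'(1) p(2) katetov_free_dist pos' few])
  moreover have ptsQ: "pts Q = pts P \<union> {p}" by (simp add: Q_def add_points_def)
  ultimately have "small_stage Q"
    using P' p(1) Un_less_\<theta>[OF P'(3) finite_less_\<theta>[of "{p}"]] by (auto simp: small_stage_def)
  moreover have "extends P Q" unfolding Q_def by (rule extends_add_points) simp
  moreover have "dst Q p s = r" if "(s, r) \<in> Z" for s r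
    using in_M[OF that] free_dist_eq[OF that] p(2)
    by (simp add: Q_def add_points_def extend_dist_def)
  ultimately show ?thesis using that ptsQ p(2) in_M by blast
qed

lemma few_small_type:
  assumes P: "small_stage P" and Z: "nonempty_type (pts P) (dst P) Z" "|Z| <o |B|"
    and B: "(z, B) \<in> marks P"
  shows "|{b \<in> B. free_dist (dst P) Z b < 2 + min 1 (free_dist (dst P) Z z)}| <o |B|"
proof -
  note v = valid_stage_marker[OF small_stageD(1)[OF P] B]
  show ?thesis
    by (rule nonempty_type.free_dist_marker[OF Z(1) v(1,3) infinite_above_\<kappa>[OF v(2)], of Z "{}"])
       (use Z(2) finite_ordLess[OF _ infinite_above_\<kappa>[OF v(2)]] in auto)
qed

lemma nonempty_typeI:
  "\<lbrakk>small_stage P; one_type (pts P) (dst P) Z; Z \<noteq> {}\<rbrakk> \<Longrightarrow> nonempty_type (pts P) (dst P) Z"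
  by (simp add: nonempty_type_def nonempty_type_axioms_def small_stageD(4))

lemma one_type_singleton:
  assumes "small_stage P" "x \<in> pts P" "0 \<le> c" shows "one_type (pts P) (dst P) {(x, c)}"
  using assms Metric_space.mdist_zero[OF small_stageD(4)[OF assms(1)], of x]
  by (simp add: one_type_def)

lemma finite_less_marks:
  assumes "small_stage P" "(z, B) \<in> marks P" "finite Z" shows "|Z| <o |B|"
  using finite_ordLess[OF assms(3) infinite_above_\<kappa>]
    valid_stage_marker(2)[OF small_stageD(1)[OF assms(1)] assms(2)] by blast

text \<open>
  Strict growth at each step is what makes the final space have \<open>\<theta>\<close> many points.
\<close>

lemma grow:
  assumes P: "small_stage P"
  obtains Q where "small_stage Q" "extends P Q" "pts P \<subset> pts Q"
proof (cases "pts P = {}")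
  case True
  note P' = small_stageD[OF P]
  obtain p where p: "p \<in> Field \<theta>" "p \<notin> pts P"
    using fresh_point[OF P'(3)] by blast
  define Q where "Q = add_points P {p} (\<lambda>_. 1) 1 {}"
  have "(z, B) \<notin> marks P" for z B
    using valid_stage_marker(1)[OF P'(1), of z B] True by (auto simp: marker_def)
  then have "valid_stage \<kappa> Q"
    unfolding Q_def by (intro valid_add_point[OF P'(1) p(2)]) (auto simp: True katetov_def)
  moreover have "pts Q = {p}" by (simp add: Q_def add_points_def True)
  moreover have "extends P Q" unfolding Q_def by (rule extends_add_points) simp
  ultimately show ?thesis
    using that[of Q] p(1) finite_less_\<theta>[of "{p}"] True by (auto simp: small_stage_def)
next
  case False
  then obtain x where x: "x \<in> pts P" by blast
  let ?Z = "{(x, 1::real)}"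
  have Z: "nonempty_type (pts P) (dst P) ?Z"
    by (rule nonempty_typeI[OF P one_type_singleton[OF P x]]) simp_all
  have "free_dist (dst P) ?Z w \<noteq> 0" for w
    using Metric_space.nonneg[OF small_stageD(4)[OF P], of x w] by (simp add: free_dist_def)
  then obtain Q p where Q: "small_stage Q" "extends P Q" "p \<in> pts Q" "p \<notin> pts P"
    by (rule add_free_point[OF P Z])
       (rule few_small_type[OF P Z finite_less_marks[OF P]], assumption, simp)
  then show ?thesis using that[OF Q(1,2)] extendsD(1)[OF Q(2)] by blast
qed

text \<open>
  If the free function vanishes somewhere, the type is already realized there, and adding a point would
  violate positivity.
\<close>

lemma realize:
  assumes P: "small_stage P" and Z: "one_type (pts P) (dst P) Z" "Z \<noteq> {}" "|Z| \<le>o \<kappa>"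
  obtains Q where "small_stage Q" "extends P Q" "realized Q Z"
proof -
  let ?F = "free_dist (dst P) Z"
  have NZ: "nonempty_type (pts P) (dst P) Z" by (rule nonempty_typeI[OF P Z(1,2)])
  interpret nonempty_type "pts P" "dst P" Z by (rule NZ)
  show ?thesis
  proof (cases "\<exists>w\<in>pts P. ?F w = 0")
    case True
    then obtain w where w: "w \<in> pts P" "?F w = 0" by blast
    have "dst P w s = r" if "(s, r) \<in> Z" for s r
    proof -
      have "?F s \<le> ?F w + dst P s w" "dst P s w \<le> ?F s + ?F w"
        using katetov_free_dist w(1) in_M[OF that] by (auto simp: katetov_def)
      then show ?thesis using w(2) free_dist_eq[OF that] by (simp add: commute)
    qed
    then have "realized P Z" using w(1) in_M unfolding realized_def by blast
    then show ?thesis using that P extends_refl by blast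
  next
    case False
    have "|Z| <o |B|" if "(z, B) \<in> marks P" for z B
      by (rule ordLeq_ordLess_trans[OF Z(3) valid_stage_marker(2)[OF small_stageD(1)[OF P] that]])
    note few = few_small_type[OF P NZ this]
    have pos: "?F w \<noteq> 0" if "w \<in> pts P" for w using False that by blast
    obtain Q p where Q: "small_stage Q" "extends P Q" "p \<in> pts Q" "p \<notin> pts P"
        "\<forall>(s, r)\<in>Z. s \<in> pts Q \<and> dst Q p s = r"
      by (rule add_free_point[OF P NZ pos few])
    have "realized Q Z" using Q(3,5) unfolding realized_def by blast
    then show ?thesis by (rule that[OF Q(1,2)])
  qed
qed

lemma mark:
  assumes P: "small_stage P" and x: "x \<in> pts P"
  obtains Q A where "small_stage Q" "extends P Q" "(x, A) \<in> marks Q"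
proof -
  note P' = small_stageD[OF P]
  obtain N where N: "N \<subseteq> Field \<theta>" "N \<inter> pts P = {}" "|N| <o \<theta>" "\<kappa> <o |N|" "|pts P| <o |N|" "stable |N|"
    using fresh_successor[OF P'(3)] by blast
  let ?Z = "{(x, 2::real)}"
  have Z: "nonempty_type (pts P) (dst P) ?Z"
    by (rule nonempty_typeI[OF P one_type_singleton[OF P x]]) simp_all
  define Q where "Q = add_points P N (\<lambda>w. 2 + dst P x w) 4 {(x, N)}"
  have F: "free_dist (dst P) ?Z w = 2 + dst P x w" for w by (simp add: free_dist_def)
  have few: "|{b \<in> B. 2 + dst P x b < 2 + min 1 (2 + dst P x z)}| <o |B|" if "(z, B) \<in> marks P" for z B
    using few_small_type[OF P Z finite_less_marks[OF P that] that] unfolding F by simp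
  have "valid_stage \<kappa> Q"
    unfolding Q_def by (rule valid_add_marker[OF P'(1) x N(2,4,6) infinite_above_\<kappa>[OF N(4)] N(5) few])
  moreover have "pts Q = pts P \<union> N" "(x, N) \<in> marks Q" by (simp_all add: Q_def add_points_def)
  moreover have "extends P Q" unfolding Q_def by (rule extends_add_points) (use N(5) in simp)
  ultimately show ?thesis
    using that[of Q N] P' N Un_less_\<theta>[OF P'(3) N(3)] by (auto simp: small_stage_def)
qed

text \<open>
  The heart of the construction. The new point \<open>p\<close> is a twin of \<open>y\<close> over \<open>x\<close> and most of \<open>A'\<close>. Copying
  the distance from \<open>y\<close> to \<open>x\<close> is essential: it is the bound that \<open>y\<close> obeys with respect to the
  markers of \<open>x\<close> which the elements of \<open>A'\<close> hand on to \<open>p\<close>.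
\<close>

lemma spoil:
  assumes P: "small_stage P" and y: "y \<in> pts P" and x: "(x, A) \<in> marks P" "x \<noteq> y"
    and A': "A' \<subseteq> pts P" "|A'| =o |A|" "\<And>a. a \<in> A' \<Longrightarrow> dst P y a = 2"
    and few: "\<And>p. \<lbrakk>p \<in> pts P; p \<noteq> y\<rbrakk> \<Longrightarrow> |{a \<in> A'. dst P p a \<le> 2}| <o |A'|"
  obtains Q where "small_stage Q" "extends P Q" "spoiled Q y A'"
proof -
  note P' = small_stageD[OF P]
  note v = valid_stage_marker[OF P'(1)]
  interpret Metric_space "pts P" "dst P" by (rule P'(4))
  let ?d = "dst P"
  have infA: "infinite A" by (rule infinite_above_\<kappa>[OF v(2)[OF x(1)]])
  have iff: "|C| <o |A'| \<longleftrightarrow> |C| <o |A|" for C :: "'l set"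
    using ordLess_ordIso_trans[OF _ A'(2)] ordLess_ordIso_trans[OF _ ordIso_symmetric[OF A'(2)]] by fast
  have xP: "x \<in> pts P" using v(1)[OF x(1)] by (simp add: marker_def)
  \<comment> \<open>The markers smaller than the support lie in \<open>U\<close>; the elements of \<open>A'\<close> near them are left out.\<close>
  define U where "U = \<Union>{B. |B| <o |A| \<and> (\<exists>z. (z, B) \<in> marks P)}"
  define R where "R = (\<Union>b\<in>U - {y}. {a \<in> A'. ?d b a \<le> 2})"
  have U: "U \<subseteq> pts P" "|U| <o |A|"
    using marker_subset[OF v(1)] v(4)[OF x(1)] by (auto simp: U_def)
  have "|R| <o |A|"
    unfolding R_def
  proof (rule stable_UNION[OF v(3)[OF x(1)]])
    show "|U - {y}| <o |A|" by (rule ordLess_subset[OF _ U(2)]) auto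
    show "|{a \<in> A'. ?d b a \<le> 2}| <o |A|" if "b \<in> U - {y}" for b
      using few[of b] U(1) that iff by blast
  qed
  moreover have "\<not> |A'| <o |A|" using not_ordLess_ordIso A'(2) by fast
  ultimately have big: "\<not> |A' - R| <o |A|"
    using ordLess_Un[OF infA, of "A' - R" R] ordLess_subset[of A' "A' - R \<union> R"] by blast

  \<comment> \<open>The prescription is \<open>max e (d y s)\<close> for \<open>s\<close> in the support; for this to agree with \<open>d y s\<close> at
    \<open>s \<noteq> y\<close> one needs \<open>e \<le> D\<close> and \<open>e \<le> 2\<close>.\<close>
  define D where "D = ?d x y"
  define e where "e = min 1 D"
  have D: "0 < D" using x(2) xP y by (simp add: D_def)
  then have e: "0 < e" "e \<le> D" "e \<le> 1" by (auto simp: e_def)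
  define Z0 where "Z0 = {(y, e), (x, D)}"
  define Z1 where "Z1 = (\<lambda>a. (a, 2::real)) ` (A' - R)"
  let ?Z = "Z0 \<union> Z1"
  have d0: "?d y y = 0" "?d x x = 0" "?d x y = D" "?d y x = D"
    using xP y by (simp_all add: D_def commute)
  have d1: "?d y a = 2" "?d a y = 2" "?d x a \<le> D + 2" "2 \<le> D + ?d a x" "D \<le> 2 + ?d x a"
      "?d a x \<le> 2 + D" if "a \<in> A'" for a
  proof -
    have a: "a \<in> pts P" "?d y a = 2" using A' that by auto
    show "?d y a = 2" "?d a y = 2" using a by (simp_all add: commute)
    show "?d x a \<le> D + 2" "2 \<le> D + ?d a x" "D \<le> 2 + ?d x a" "?d a x \<le> 2 + D"
      using triangle[OF xP y a(1)] triangle[OF y xP a(1)] triangle[OF xP a(1) y] a d0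
      by (simp_all add: commute)
  qed
  have d2: "?d a b \<le> 4" if "a \<in> A'" "b \<in> A'" for a b
    using triangle[of a y b] d1[OF that(1)] d1[OF that(2)] A' y that by auto
  have type: "one_type (pts P) ?d ?Z"
  proof (rule one_typeI)
    show "s \<in> pts P" if "(s, r) \<in> ?Z" for s r
      using that xP y A'(1) by (auto simp: Z0_def Z1_def)
    show "r \<le> q + ?d s t \<and> ?d s t \<le> r + q" if "(s, r) \<in> ?Z" "(t, q) \<in> ?Z" for s r t q
      using that D e unfolding Z0_def Z1_def by (auto simp: d0 d1 d2)
  qed
  have NZ: "nonempty_type (pts P) ?d ?Z"
    by (rule nonempty_typeI[OF P type]) (simp add: Z0_def)
  interpret nonempty_type "pts P" ?d ?Z by (rule NZ)
  let ?F = "free_dist ?d ?Z"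
  have pos: "?F w \<noteq> 0" for w
  proof -
    have "e \<le> ?F w"
    proof (rule free_dist_greatest)
      fix s r assume "(s, r) \<in> ?Z"
      then have "e \<le> r" using e by (auto simp: Z0_def Z1_def)
      then show "e \<le> r + ?d s w" using nonneg[of s w] by linarith
    qed
    then show ?thesis using e by linarith
  qed
  have Fx: "?F x = D" by (rule free_dist_eq) (simp add: Z0_def)
  have few': "|{b \<in> B. ?F b < 2 + min 1 (?F z)}| <o |B|" if B: "(z, B) \<in> marks P" for z B
  proof -
    note vB = v[OF B]
    have infB: "infinite B" by (rule infinite_above_\<kappa>[OF vB(2)])
    have Z0B: "|Z0| <o |B|" by (rule finite_ordLess[OF _ infB]) (simp add: Z0_def)
    consider "|A| <o |B|" | "|A| =o |B|" | "|B| <o |A|"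
      using ordLess_or_ordLeq[OF card_of_Well_order card_of_Well_order, of A B]
        ordLeq_iff_ordLess_or_ordIso ordIso_symmetric by blast
    then show ?thesis
    proof cases
      case 1
      have "|Z1| \<le>o |A' - R|" unfolding Z1_def by (rule card_of_image)
      also have "|A' - R| \<le>o |A'|" by (rule card_of_mono1) auto
      also have "|A'| =o |A|" by (rule A'(2))
      finally have "|Z1| <o |B|" using 1 by (rule ordLeq_ordLess_trans)
      then have "|?Z| <o |B|" by (rule ordLess_Un[OF infB Z0B])
      then show ?thesis by (rule few_small_type[OF P NZ _ B])
    next
      case 2
      then have z: "z = x" using valid_stage_inj[OF P'(1) x(1) B] by simp
      \<comment> \<open>An element of \<open>B\<close> that is close to \<open>A'\<close> is too close to \<open>y\<close>.\<close>
      have "{b \<in> B. \<exists>(s, r)\<in>Z1. r + ?d s b < 2 + min 1 (?F z)} \<subseteq> {b \<in> B. ?d y b < 2 + min 1 (?d y z)}"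
      proof clarify
        fix b s r assume b: "b \<in> B" "(s, r) \<in> Z1" "r + ?d s b < 2 + min 1 (?F z)"
        then have s: "s \<in> A'" "r = 2" by (auto simp: Z1_def)
        have "b \<in> pts P" using marker_subset[OF vB(1)] b(1) by auto
        then have "?d y b \<le> 2 + ?d s b"
          using triangle[OF y _ \<open>b \<in> pts P\<close>, of s] s(1) A'(1) d1(1)[OF s(1)] by auto
        then show "?d y b < 2 + min 1 (?d y z)" using b(3) s(2) Fx d0 unfolding z by linarith
      qed
      then have "|{b \<in> B. \<exists>(s, r)\<in>Z1. r + ?d s b < 2 + min 1 (?F z)}| <o |B|"
        by (rule ordLess_subset) (use vB(1) y in \<open>simp add: marker_def\<close>)
      then show ?thesis by (rule free_dist_marker[OF vB(1,3) infB refl Z0B])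
    next
      case 3
      \<comment> \<open>The elements of \<open>B\<close> other than \<open>y\<close> have distance more than \<open>2\<close> from \<open>A' - R\<close>, so paths through
        \<open>A' - R\<close> are longer than \<open>4\<close>.\<close>
      have "{b \<in> B. \<exists>(s, r)\<in>Z1. r + ?d s b < 2 + min 1 (?F z)} \<subseteq> {y}"
      proof clarify
        fix b s r assume b: "b \<in> B" "(s, r) \<in> Z1" "r + ?d s b < 2 + min 1 (?F z)"
        then have s: "s \<in> A'" "s \<notin> R" "r = 2" by (auto simp: Z1_def)
        have "b \<in> U" using 3 B b(1) by (auto simp: U_def)
        moreover have "?d b s \<le> 2" using b(3) s(3) by (simp add: commute)
        ultimately show "b = y" using s by (auto simp: R_def)
      qed
      then have "|{b \<in> B. \<exists>(s, r)\<in>Z1. r + ?d s b < 2 + min 1 (?F z)}| <o |B|"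
        by (rule ordLess_subset) (rule finite_ordLess[OF _ infB], simp)
      then show ?thesis by (rule free_dist_marker[OF vB(1,3) infB refl Z0B])
    qed
  qed
  obtain Q p where Q: "small_stage Q" "extends P Q" "p \<in> pts Q" "p \<notin> pts P"
      "\<forall>(s, r)\<in>?Z. s \<in> pts Q \<and> dst Q p s = r"
    by (rule add_free_point[OF P NZ pos few'])
  have "A' - R \<subseteq> {a \<in> A'. dst Q p a \<le> 2}"
    using Q(5) by (force simp: Z1_def)
  then have "\<not> |{a \<in> A'. dst Q p a \<le> 2}| <o |A'|"
    using big ordLess_subset iff by blast
  moreover have "p \<noteq> y" using Q(4) y by auto
  moreover have "A' \<subseteq> pts Q" using A'(1) extendsD(1)[OF Q(2)] by auto
  ultimately have "spoiled Q y A'" using Q(3) unfolding spoiled_def by blast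
  then show ?thesis by (rule that[OF Q(1,2)])
qed

text \<open>
  A task \<open>(Z, y)\<close> serves three purposes: realize \<open>Z\<close> if it is a small type, give \<open>y\<close> a marker, and spoil
  the set of points mentioned in \<open>Z\<close> as a candidate for \<open>y\<close>. Each part is conditional on making
  sense in the space at hand, so that every task can be presented to every stage.
\<close>

definition step :: "'l stage \<Rightarrow> ('l \<times> real) set \<times> 'l \<Rightarrow> 'l stage \<Rightarrow> bool" where
  "step P t Q \<longleftrightarrow> small_stage Q \<and> extends P Q \<and> pts P \<subset> pts Q \<and>
     (case t of (Z, y) \<Rightarrow>
       (one_type (pts P) (dst P) Z \<and> Z \<noteq> {} \<and> |Z| \<le>o \<kappa> \<longrightarrow> realized Q Z) \<and>
       (y \<in> pts P \<longrightarrow> (\<exists>A. (y, A) \<in> marks Q)) \<and>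
       (\<forall>x A. y \<in> pts P \<and> (x, A) \<in> marks P \<and> x \<noteq> y \<and> fst ` Z \<subseteq> pts P \<and> |fst ` Z| =o |A| \<and>
          (\<forall>a\<in>fst ` Z. dst P y a = 2) \<longrightarrow> spoiled Q y (fst ` Z)))"

lemma step_spoiled:
  assumes "step P (Z, y) Q" "y \<in> pts P" "(x, A) \<in> marks P" "x \<noteq> y"
    and "fst ` Z \<subseteq> pts P" "|fst ` Z| =o |A|" "\<And>a. a \<in> fst ` Z \<Longrightarrow> dst P y a = 2"
  shows "spoiled Q y (fst ` Z)"
proof -
  have "\<forall>x A. y \<in> pts P \<and> (x, A) \<in> marks P \<and> x \<noteq> y \<and> fst ` Z \<subseteq> pts P \<and> |fst ` Z| =o |A| \<and>
          (\<forall>a\<in>fst ` Z. dst P y a = 2) \<longrightarrow> spoiled Q y (fst ` Z)"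
    using assms(1) unfolding step_def prod.case by (elim conjE)
  from this[rule_format, of x A] assms(2-7) show ?thesis by blast
qed

lemma one_type_mono:
  assumes "extends P Q" "one_type (pts P) (dst P) Z" shows "one_type (pts Q) (dst Q) Z"
proof (rule one_typeI)
  note Z = one_typeD[OF assms(2)]
  show "s \<in> pts Q" if "(s, r) \<in> Z" for s r
    using Z(1)[OF that] extendsD(1)[OF assms(1)] by auto
  show "r \<le> q + dst Q s t \<and> dst Q s t \<le> r + q" if "(s, r) \<in> Z" "(t, q) \<in> Z" for s r t q
    using Z(2)[OF that] extendsD(2)[OF assms(1) Z(1)[OF that(1)] Z(1)[OF that(2)]] by simp
qed

lemma step_exists:
  assumes P: "small_stage P" shows "\<exists>Q. step P t Q"
proof -
  obtain Z y where t: "t = (Z, y)" by force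
  obtain Q1 where Q1: "small_stage Q1" "extends P Q1" "pts P \<subset> pts Q1"
    by (rule grow[OF P])
  obtain Q2 where Q2: "small_stage Q2" "extends Q1 Q2"
    "one_type (pts P) (dst P) Z \<and> Z \<noteq> {} \<and> |Z| \<le>o \<kappa> \<longrightarrow> realized Q2 Z"
  proof (cases "one_type (pts P) (dst P) Z \<and> Z \<noteq> {} \<and> |Z| \<le>o \<kappa>")
    case True
    then obtain Q where "small_stage Q" "extends Q1 Q" "realized Q Z"
      using realize[OF Q1(1) one_type_mono[OF Q1(2)]] by blast
    then show ?thesis using that by blast
  next
    case False
    show ?thesis by (rule that[OF Q1(1) extends_refl]) (use False in blast)
  qed
  have PQ2: "extends P Q2" by (rule extends_trans[OF Q1(2) Q2(2)])
  obtain Q3 where Q3: "small_stage Q3" "extends Q2 Q3" "y \<in> pts P \<longrightarrow> (\<exists>A. (y, A) \<in> marks Q3)"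
  proof (cases "y \<in> pts P")
    case True
    then have "y \<in> pts Q2" using extendsD(1)[OF PQ2] by auto
    then obtain Q A where "small_stage Q" "extends Q2 Q" "(y, A) \<in> marks Q"
      by (rule mark[OF Q2(1)])
    then show ?thesis using that by blast
  next
    case False
    show ?thesis by (rule that[OF Q2(1) extends_refl]) (use False in blast)
  qed
  have PQ3: "extends P Q3" by (rule extends_trans[OF PQ2 Q3(2)])
  let ?H = "\<lambda>x A. y \<in> pts P \<and> (x, A) \<in> marks P \<and> x \<noteq> y \<and> fst ` Z \<subseteq> pts P \<and> |fst ` Z| =o |A| \<and>
          (\<forall>a\<in>fst ` Z. dst P y a = 2)"
  obtain Q4 where Q4: "small_stage Q4" "extends Q3 Q4" "\<forall>x A. ?H x A \<longrightarrow> spoiled Q4 y (fst ` Z)"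
  proof (cases "(\<exists>x A. ?H x A) \<and> \<not> spoiled Q3 y (fst ` Z)")
    case True
    then obtain x A where H: "?H x A" and ns: "\<not> spoiled Q3 y (fst ` Z)" by blast
    have Z3: "fst ` Z \<subseteq> pts Q3" using H extendsD(1)[OF PQ3] by blast
    have "dst Q3 y a = 2" if "a \<in> fst ` Z" for a
      using extendsD(2)[OF PQ3, of y a] H that by auto
    moreover have "|{a \<in> fst ` Z. dst Q3 p a \<le> 2}| <o |fst ` Z|" if "p \<in> pts Q3" "p \<noteq> y" for p
      using ns that Z3 unfolding spoiled_def by blast
    moreover have "y \<in> pts Q3" "(x, A) \<in> marks Q3" "x \<noteq> y" "|fst ` Z| =o |A|"
      using H extendsD(1,3)[OF PQ3] by auto
    ultimately obtain Q where "small_stage Q" "extends Q3 Q" "spoiled Q y (fst ` Z)"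
      using spoil[OF Q3(1) _ _ _ Z3] by blast
    then show ?thesis using that by blast
  next
    case False
    show ?thesis by (rule that[OF Q3(1) extends_refl]) (use False in blast)
  qed
  have PQ4: "extends P Q4" by (rule extends_trans[OF PQ3 Q4(2)])
  have Q24: "extends Q2 Q4" by (rule extends_trans[OF Q3(2) Q4(2)])
  have "pts P \<subset> pts Q4"
    using Q1(3) extendsD(1)[OF Q2(2)] extendsD(1)[OF Q24] by blast
  moreover have "y \<in> pts P \<longrightarrow> (\<exists>A. (y, A) \<in> marks Q4)"
    using Q3(3) extendsD(3)[OF Q4(2)] by blast
  moreover have "one_type (pts P) (dst P) Z \<and> Z \<noteq> {} \<and> |Z| \<le>o \<kappa> \<longrightarrow> realized Q4 Z"
    using Q2(3) realized_mono[OF Q24] by blast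
  ultimately have "step P t Q4"
    unfolding step_def t using Q4(1,3) PQ4 by simp
  then show ?thesis ..
qed

section \<open>A chain of length \<open>\<theta>\<close>\<close>

text \<open>
  Dedekind cuts; the real distances in a task must not increase the number of tasks beyond \<open>\<theta>\<close>.
\<close>

lemma real_less_\<theta>: "|UNIV :: real set| <o \<theta>"
proof -
  have "|UNIV :: rat set| \<le>o natLeq"
    using card_of_nat card_of_ordLeq[of "UNIV :: rat set" "UNIV :: nat set"] to_nat_on_finite
    by (metis countableE countableI_type ordLeq_ordIso_trans subset_UNIV)
  then have "|UNIV :: rat set| <o \<theta>" by (rule ordLeq_ordLess_trans[OF _ natLeq_\<theta>])
  then have P: "|Pow (UNIV :: rat set)| <o \<theta>" by (rule Pow_less_\<theta>)
  have "inj (\<lambda>x::real. {q::rat. of_rat q < x})"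
  proof (rule linorder_injI)
    fix x y :: real assume "x < y"
    then obtain q where "x < of_rat q" "of_rat q < y" using of_rat_dense by blast
    then have "q \<in> {q. of_rat q < y}" "q \<notin> {q. of_rat q < x}" by auto
    then show "{q. of_rat q < x} \<noteq> {q. of_rat q < y}" by blast
  qed
  then have "|UNIV :: real set| \<le>o |Pow (UNIV :: rat set)|"
    by (intro card_of_ordLeqI) auto
  then show ?thesis by (rule ordLeq_ordLess_trans[OF _ P])
qed

lemma wo_\<theta>: "wo_rel \<theta>"
  using card_order_on_well_order_on[OF card_\<theta>] by (simp add: wo_rel_def)

lemma under_less_\<theta>: "i \<in> Field \<theta> \<Longrightarrow> |under \<theta> i| <o \<theta>"
proof -
  assume i: "i \<in> Field \<theta>"
  have "under \<theta> i \<subseteq> underS \<theta> i \<union> {i}" by (auto simp: under_def underS_def)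
  then show ?thesis
    by (rule ordLess_subset) (rule Un_less_\<theta>[OF card_of_underS[OF card_\<theta> i] finite_less_\<theta>], simp)
qed

lemma underS_\<theta>: "underS \<theta> i \<subseteq> Field \<theta>"
  by (auto simp: underS_def Field_def)

lemma \<theta>_total: "\<lbrakk>i \<in> Field \<theta>; j \<in> Field \<theta>\<rbrakk> \<Longrightarrow> i = j \<or> i \<in> underS \<theta> j \<or> j \<in> underS \<theta> i"
  using wo_rel.TOTALS[OF wo_\<theta>] by (auto simp: underS_def)

lemma \<theta>_refl: "i \<in> Field \<theta> \<Longrightarrow> (i, i) \<in> \<theta>"
  using wo_rel.REFL[OF wo_\<theta>] by (simp add: refl_on_def)

lemma Field_le_\<theta>: "|Field \<theta>| \<le>o \<theta>"
  using card_of_Field_ordIso[OF card_\<theta>] by (rule ordIso_imp_ordLeq)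

definition tasks :: "(('l \<times> real) set \<times> 'l) set" where
  "tasks = {Z. Z \<subseteq> Field \<theta> \<times> UNIV \<and> |Z| <o \<theta>} \<times> Field \<theta>"

text \<open>
  A small subset of \<open>\<theta>\<close> is bounded by regularity, and each initial segment has fewer than \<open>\<theta>\<close> subsets.
\<close>

lemma card_small_subsets: "|{V. V \<subseteq> Field \<theta> \<and> |V| <o \<theta>}| \<le>o \<theta>"
proof -
  have "{V. V \<subseteq> Field \<theta> \<and> |V| <o \<theta>} \<subseteq> (\<Union>i\<in>Field \<theta>. Pow (under \<theta> i))"
  proof clarify
    fix V assume V: "V \<subseteq> Field \<theta>" "|V| <o \<theta>"
    have "\<exists>i\<in>Field \<theta>. V \<subseteq> under \<theta> i"
    proof (rule regularCard_UNION[OF card_\<theta> regular_\<theta> _ _ V(2)])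
      show "relChain \<theta> (under \<theta>)"
        using wo_rel.TRANS[OF wo_\<theta>] by (auto simp: relChain_def under_def dest: transD)
      show "V \<subseteq> (\<Union>i\<in>Field \<theta>. under \<theta> i)"
        using V(1) \<theta>_refl by (auto simp: under_def)
    qed
    then show "V \<in> (\<Union>i\<in>Field \<theta>. Pow (under \<theta> i))" by blast
  qed
  moreover have "|\<Union>i\<in>Field \<theta>. Pow (under \<theta> i)| \<le>o \<theta>"
    by (rule card_of_UNION_ordLeq_infinite_Field[OF infinite_\<theta> card_\<theta> Field_le_\<theta>])
       (use Pow_less_\<theta>[OF under_less_\<theta>] ordLess_imp_ordLeq in blast)
  ultimately show ?thesis by (rule ordLeq_transitive[OF card_of_mono1])
qed

lemma card_tasks: "|tasks| \<le>o \<theta>"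
proof -
  let ?W = "Field \<theta> \<times> (UNIV :: real set)"
  have "|?W| \<le>o \<theta>"
    by (rule card_of_Times_ordLeq_infinite_Field[OF infinite_\<theta> Field_le_\<theta>
          ordLess_imp_ordLeq[OF real_less_\<theta>] card_\<theta>])
  then have "|?W| \<le>o |Field \<theta>|"
    by (rule ordLeq_ordIso_trans[OF _ ordIso_symmetric[OF card_of_Field_ordIso[OF card_\<theta>]]])
  then obtain h where h: "inj_on h ?W" "h ` ?W \<subseteq> Field \<theta>"
    by (metis card_of_ordLeq)
  let ?T = "{Z. Z \<subseteq> ?W \<and> |Z| <o \<theta>}"
  have inj: "inj_on ((`) h) ?T"
    by (rule inj_on_subset[OF inj_on_image_Pow[OF h(1)]]) auto
  have "(`) h ` ?T \<subseteq> {V. V \<subseteq> Field \<theta> \<and> |V| <o \<theta>}"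
    using h(2) by (auto intro: ordLeq_ordLess_trans[OF card_of_image])
  then have "|?T| \<le>o |{V. V \<subseteq> Field \<theta> \<and> |V| <o \<theta>}|"
    by (intro card_of_ordLeqI[OF inj]) blast
  then have "|?T| \<le>o \<theta>" by (rule ordLeq_transitive[OF _ card_small_subsets])
  then show ?thesis
    unfolding tasks_def
    by (rule card_of_Times_ordLeq_infinite_Field[OF infinite_\<theta> _ Field_le_\<theta> card_\<theta>])
qed

text \<open>
  Each task recurs cofinally often, since it may become meaningful only late in the chain.
\<close>

lemma enumeration:
  obtains e where "\<And>t i. \<lbrakk>t \<in> tasks; i \<in> Field \<theta>\<rbrakk> \<Longrightarrow> \<exists>k\<in>Field \<theta>. i \<in> underS \<theta> k \<and> e k = t"
proof -
  have "|tasks \<times> Field \<theta>| \<le>o \<theta>"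
    by (rule card_of_Times_ordLeq_infinite_Field[OF infinite_\<theta> card_tasks Field_le_\<theta> card_\<theta>])
  then have le: "|tasks \<times> Field \<theta>| \<le>o |Field \<theta>|"
    by (rule ordLeq_ordIso_trans[OF _ ordIso_symmetric[OF card_of_Field_ordIso[OF card_\<theta>]]])
  obtain i0 where "i0 \<in> Field \<theta>" using infinite_\<theta> by (metis ex_in_conv finite.emptyI)
  then have "({}, i0) \<in> tasks" using finite_less_\<theta>[of "{}"] by (simp add: tasks_def)
  then have "tasks \<times> Field \<theta> \<noteq> {}" using \<open>i0 \<in> Field \<theta>\<close> by blast
  then obtain g where g: "g ` Field \<theta> = tasks \<times> Field \<theta>"
    using iffD2[OF card_of_ordLeq2 le] by blast
  show ?thesis
  proof (rule that[of "fst \<circ> g"])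
    fix t i assume t: "t \<in> tasks" and i: "i \<in> Field \<theta>"
    have "\<exists>k\<in>Field \<theta>. fst (g k) = t \<and> k \<notin> under \<theta> i"
    proof (rule ccontr)
      assume no: "\<not> ?thesis"
      have "Field \<theta> \<subseteq> (snd \<circ> g) ` under \<theta> i"
      proof
        fix j assume "j \<in> Field \<theta>"
        then have "(t, j) \<in> g ` Field \<theta>" using t g by simp
        then obtain k where "k \<in> Field \<theta>" "g k = (t, j)" by (metis imageE)
        then show "j \<in> (snd \<circ> g) ` under \<theta> i" using no by force
      qed
      then have "|Field \<theta>| <o \<theta>"
        by (rule ordLess_subset[OF _ ordLeq_ordLess_trans[OF card_of_image under_less_\<theta>[OF i]]])
      then show False using not_ordLess_ordIso card_of_Field_ordIso[OF card_\<theta>] by fast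
    qed
    then obtain k where k: "k \<in> Field \<theta>" "fst (g k) = t" "k \<notin> under \<theta> i" by blast
    have "i \<in> underS \<theta> k"
      using \<theta>_total[OF i k(1)] k(3) \<theta>_refl[OF i] by (auto simp: under_def underS_def)
    then show "\<exists>k\<in>Field \<theta>. i \<in> underS \<theta> k \<and> (fst \<circ> g) k = t" using k by auto
  qed
qed

lemma chain_of_steps:
  "\<exists>F. \<forall>i\<in>Field \<theta>. step (Sup_stage (F ` underS \<theta> i)) (e i) (F i) \<and>
     (\<forall>j\<in>underS \<theta> i. extends (F j) (F i))"
proof -
  let ?H = "\<lambda>f i. SOME Q. step (Sup_stage (f ` underS \<theta> i)) (e i) Q"
  define F where "F = wfrec (\<theta> - Id) ?H"
  have wf: "wf (\<theta> - Id)"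
    using card_order_on_well_order_on[OF card_\<theta>] by (simp add: well_order_on_def)
  have F: "F i = (SOME Q. step (Sup_stage (F ` underS \<theta> i)) (e i) Q)" for i
  proof -
    have "cut F (\<theta> - Id) i ` underS \<theta> i = F ` underS \<theta> i"
      by (rule image_cong) (auto simp: underS_def cut_apply)
    then show ?thesis
      using wfrec[OF wf, of ?H i] by (simp add: F_def)
  qed
  have "i \<in> Field \<theta> \<longrightarrow> step (Sup_stage (F ` underS \<theta> i)) (e i) (F i) \<and>
      (\<forall>j\<in>underS \<theta> i. extends (F j) (F i))" for i
  proof (induction i rule: wf_induct_rule[OF wf])
    case (1 i)
    show ?case
    proof
      assume i: "i \<in> Field \<theta>"
      let ?C = "F ` underS \<theta> i"
      have IH: "j \<in> Field \<theta>" "small_stage (F j)" "\<And>k. k \<in> underS \<theta> j \<Longrightarrow> extends (F k) (F j)"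
        if "j \<in> underS \<theta> i" for j
      proof -
        show j: "j \<in> Field \<theta>" using that by (auto simp: underS_def Field_def)
        have "(j, i) \<in> \<theta> - Id" using that by (simp add: underS_def)
        from 1[OF this] j show "small_stage (F j)" "\<And>k. k \<in> underS \<theta> j \<Longrightarrow> extends (F k) (F j)"
          by (auto simp: step_def)
      qed
      have chain: "extends P Q \<or> extends Q P" if PQ: "P \<in> ?C" "Q \<in> ?C" for P Q
      proof -
        obtain j k where jk: "j \<in> underS \<theta> i" "k \<in> underS \<theta> i" "P = F j" "Q = F k"
          using PQ by blast
        consider "j = k" | "j \<in> underS \<theta> k" | "k \<in> underS \<theta> j"
          using \<theta>_total[OF IH(1)[OF jk(1)] IH(1)[OF jk(2)]] by blast
        then show ?thesis
          by cases (use IH(3) jk extends_refl in simp_all)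
      qed
      have valid: "valid_stage \<kappa> P" if "P \<in> ?C" for P
        using that IH(2) small_stageD(1) by blast
      have pts: "pts (Sup_stage ?C) = (\<Union>j\<in>underS \<theta> i. pts (F j))" by (simp add: Sup_stage_def)
      have "|pts (Sup_stage ?C)| <o \<theta>"
        unfolding pts by (rule stable_UNION[OF stable_\<theta> card_of_underS[OF card_\<theta> i]])
          (rule small_stageD(3)[OF IH(2)])
      moreover have "pts (Sup_stage ?C) \<subseteq> Field \<theta>"
        unfolding pts using small_stageD(2)[OF IH(2)] by blast
      ultimately have "small_stage (Sup_stage ?C)"
        using valid_Sup_stage[OF chain valid] by (simp add: small_stage_def)
      then have st: "step (Sup_stage ?C) (e i) (F i)"
        unfolding F[of i] by (rule someI_ex[OF step_exists])
      have "extends (F j) (F i)" if "j \<in> underS \<theta> i" for j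
      proof (rule extends_trans)
        show "extends (F j) (Sup_stage ?C)"
          by (rule extends_Sup_stage[OF chain valid]) (use that in auto)
        show "extends (Sup_stage ?C) (F i)" using st by (simp add: step_def)
      qed
      with st show "step (Sup_stage ?C) (e i) (F i) \<and> (\<forall>j\<in>underS \<theta> i. extends (F j) (F i))"
        by blast
    qed
  qed
  then show ?thesis by blast
qed

text \<open>
  All that is needed of the limit: for each small part \<open>V\<close>, each task has been carried out at a
  stage that already contained \<open>V\<close>.
\<close>

definition rich_stage :: "'l stage \<Rightarrow> bool" where
  "rich_stage X \<longleftrightarrow> valid_stage \<kappa> X \<and> pts X \<subseteq> Field \<theta> \<and> |pts X| =o \<theta> \<and>
     (\<forall>V t. V \<subseteq> pts X \<and> |V| <o \<theta> \<and> t \<in> tasks \<longrightarrow>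
       (\<exists>S Q. V \<subseteq> pts S \<and> extends S X \<and> step S t Q \<and> extends Q X))"

lemma rich_stageD:
  assumes "rich_stage X"
  shows "valid_stage \<kappa> X" "pts X \<subseteq> Field \<theta>" "|pts X| =o \<theta>"
    "\<lbrakk>V \<subseteq> pts X; |V| <o \<theta>; t \<in> tasks\<rbrakk> \<Longrightarrow>
       \<exists>S Q. V \<subseteq> pts S \<and> extends S X \<and> step S t Q \<and> extends Q X"
  using assms unfolding rich_stage_def by blast+

lemma rich_stage_exists: "\<exists>X. rich_stage X"
proof -
  obtain e where e: "\<And>t i. \<lbrakk>t \<in> tasks; i \<in> Field \<theta>\<rbrakk> \<Longrightarrow> \<exists>k\<in>Field \<theta>. i \<in> underS \<theta> k \<and> e k = t"
    by (rule enumeration) blast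
  obtain F where "\<forall>i\<in>Field \<theta>. step (Sup_stage (F ` underS \<theta> i)) (e i) (F i) \<and>
      (\<forall>j\<in>underS \<theta> i. extends (F j) (F i))"
    using chain_of_steps[of e] by blast
  then have F: "\<And>i. i \<in> Field \<theta> \<Longrightarrow> step (Sup_stage (F ` underS \<theta> i)) (e i) (F i)"
    "\<And>i j. \<lbrakk>i \<in> Field \<theta>; j \<in> underS \<theta> i\<rbrakk> \<Longrightarrow> extends (F j) (F i)"
    by blast+
  let ?S = "\<lambda>i. Sup_stage (F ` underS \<theta> i)"
  define X where "X = Sup_stage (F ` Field \<theta>)"
  have small: "small_stage (F i)" if "i \<in> Field \<theta>" for i
    using F(1)[OF that] by (simp add: step_def)
  have chain: "extends P Q \<or> extends Q P" if PQ: "P \<in> F ` Field \<theta>" "Q \<in> F ` Field \<theta>" for P Q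
  proof -
    obtain j k where jk: "j \<in> Field \<theta>" "k \<in> Field \<theta>" "P = F j" "Q = F k"
      using PQ by blast
    consider "j = k" | "j \<in> underS \<theta> k" | "k \<in> underS \<theta> j"
      using \<theta>_total[OF jk(1,2)] by blast
    then show ?thesis
      by cases (use F(2) jk extends_refl in simp_all)
  qed
  have valid: "valid_stage \<kappa> P" if "P \<in> F ` Field \<theta>" for P
    using that small small_stageD(1) by blast
  have FX: "extends (F i) X" if "i \<in> Field \<theta>" for i
    unfolding X_def by (rule extends_Sup_stage[OF chain valid]) (use that in auto)
  have ptsX: "pts X = (\<Union>i\<in>Field \<theta>. pts (F i))" by (simp add: X_def Sup_stage_def)
  have below: "extends (F j) (?S i)" if "i \<in> Field \<theta>" "j \<in> underS \<theta> i" for i j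
  proof (rule extends_Sup_stage)
    note sub = subsetD[OF image_mono[OF underS_\<theta>], of _ F i]
    show "extends P Q \<or> extends Q P" if "P \<in> F ` underS \<theta> i" "Q \<in> F ` underS \<theta> i" for P Q
      by (rule chain[OF sub[OF that(1)] sub[OF that(2)]])
    show "valid_stage \<kappa> P" if "P \<in> F ` underS \<theta> i" for P
      by (rule valid[OF sub[OF that]])
    show "F j \<in> F ` underS \<theta> i" by (rule imageI[OF that(2)])
  qed
  have "rich_stage X"
    unfolding rich_stage_def
  proof (intro conjI allI impI; (elim conjE)?)
    show "valid_stage \<kappa> X" unfolding X_def by (rule valid_Sup_stage[OF chain valid])
    show sub: "pts X \<subseteq> Field \<theta>" unfolding ptsX using small_stageD(2)[OF small] by blast
    have "\<exists>p. p \<in> pts (F i) \<and> p \<notin> pts (?S i)" if "i \<in> Field \<theta>" for i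
      using F(1)[OF that] by (auto simp: step_def)
    then obtain p where p: "\<And>i. i \<in> Field \<theta> \<Longrightarrow> p i \<in> pts (F i) \<and> p i \<notin> pts (?S i)"
      by metis
    have neq: "p j \<noteq> p i" if "i \<in> Field \<theta>" "j \<in> underS \<theta> i" for i j
    proof -
      have "j \<in> Field \<theta>" using that(2) underS_\<theta> by blast
      then show ?thesis using p[of j] p[OF that(1)] extendsD(1)[OF below[OF that]] by auto
    qed
    have "inj_on p (Field \<theta>)"
      by (rule inj_onI) (metis \<theta>_total neq)
    then have "|Field \<theta>| \<le>o |pts X|"
      by (rule card_of_ordLeqI) (use p in \<open>auto simp: ptsX\<close>)
    then have "\<theta> \<le>o |pts X|"
      by (rule ordIso_ordLeq_trans[OF ordIso_symmetric[OF card_of_Field_ordIso[OF card_\<theta>]]])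
    moreover have "|pts X| \<le>o \<theta>" by (rule ordLeq_transitive[OF card_of_mono1[OF sub] Field_le_\<theta>])
    ultimately show "|pts X| =o \<theta>" by (simp add: ordIso_iff_ordLeq)
    fix V t assume V: "V \<subseteq> pts X" "|V| <o \<theta>" and t: "t \<in> tasks"
    have "\<exists>i\<in>Field \<theta>. V \<subseteq> pts (F i)"
    proof (rule regularCard_UNION[OF card_\<theta> regular_\<theta> _ _ V(2)])
      show "relChain \<theta> (\<lambda>i. pts (F i))"
        unfolding relChain_def
      proof (intro allI impI)
        fix i j assume ij: "(i, j) \<in> \<theta>"
        then have j: "j \<in> Field \<theta>" by (auto simp: Field_def)
        show "pts (F i) \<subseteq> pts (F j)"
          using extendsD(1)[OF F(2)[OF j]] ij by (cases "i = j") (auto simp: underS_def)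
      qed
    qed (use V(1) ptsX in simp)
    then obtain i where i: "i \<in> Field \<theta>" "V \<subseteq> pts (F i)" by blast
    obtain k where k: "k \<in> Field \<theta>" "i \<in> underS \<theta> k" "e k = t" using e[OF t i(1)] by blast
    have st: "step (?S k) t (F k)" using F(1)[OF k(1)] k(3) by simp
    then have "extends (?S k) (F k)" by (simp add: step_def)
    then have "extends (?S k) X" by (rule extends_trans[OF _ FX[OF k(1)]])
    moreover have "V \<subseteq> pts (?S k)" using i(2) extendsD(1)[OF below[OF k(1,2)]] by auto
    ultimately show "\<exists>S Q. V \<subseteq> pts S \<and> extends S X \<and> step S t Q \<and> extends Q X"
      using st FX[OF k(1)] by blast
  qed
  then show ?thesis ..
qed

section \<open>The limit space\<close>

lemma stage_metric:
  assumes "valid_stage \<kappa> X"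
  shows "mspace (metric (pts X, dst X)) = pts X" "mdist (metric (pts X, dst X)) = dst X"
  using Metric_space.mspace_metric Metric_space.mdist_metric valid_stage_metric[OF assms] by blast+

text \<open>
  If \<open>f\<close> moves \<open>x\<close>, the image of a marker \<open>A\<close> of \<open>x\<close> has been spoiled by some point \<open>p \<noteq> f x\<close>; the preimage
  of \<open>p\<close> then is a point other than \<open>x\<close> within distance \<open>2\<close> of \<open>|A|\<close> many elements of \<open>A\<close>.
\<close>

lemma rigid_rich_stage:
  assumes rich_X: "rich_stage X"
  shows "rigid_metric (metric (pts X, dst X))"
  unfolding rigid_metric_def stage_metric[OF rich_stageD(1)[OF rich_X]]
proof (intro allI impI ballI)
  note X = rich_stageD(1,2)[OF rich_X] and rich = rich_stageD(4)[OF rich_X]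
  interpret Metric_space "pts X" "dst X" by (rule valid_stage_metric[OF X(1)])
  let ?d = "dst X"
  fix f x assume "isometric_embedding (metric (pts X, ?d)) (metric (pts X, ?d)) f \<and> bij_betw f (pts X) (pts X)"
    and x: "x \<in> pts X"
  then have f: "\<And>u. u \<in> pts X \<Longrightarrow> f u \<in> pts X" "\<And>u v. \<lbrakk>u \<in> pts X; v \<in> pts X\<rbrakk> \<Longrightarrow> ?d (f u) (f v) = ?d u v"
    and bij: "bij_betw f (pts X) (pts X)"
    by (auto simp: isometric_embedding_def stage_metric[OF X(1)])
  show "f x = x"
  proof (rule ccontr)
    assume neq: "f x \<noteq> x"
    have "({}, x) \<in> tasks" using x X(2) finite_less_\<theta>[of "{}"] by (auto simp: tasks_def)
    then obtain S0 Q0 where Q0: "{x} \<subseteq> pts S0" "step S0 ({}, x) Q0" "extends Q0 X"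
      using rich[of "{x}"] x finite_less_\<theta>[of "{x}"] by blast
    then obtain A where "(x, A) \<in> marks Q0" and small: "small_stage Q0" by (auto simp: step_def)
    then have A: "(x, A) \<in> marks X" "A \<subseteq> pts Q0"
      using extendsD(3)[OF Q0(3)] marker_subset[OF valid_stage_marker(1)[OF small_stageD(1)]] by auto
    have A\<theta>: "|A| <o \<theta>" by (rule ordLess_subset[OF A(2) small_stageD(3)[OF small]])
    have mk: "marker (pts X) ?d x A" by (rule valid_stage_marker(1)[OF X(1) A(1)])
    have AX: "A \<subseteq> pts X" by (rule marker_subset[OF mk])
    let ?A = "f ` A"
    define Z where "Z = ?A \<times> {0::real}"
    have fstZ: "fst ` Z = ?A" by (simp add: Z_def)
    have A'\<theta>: "|?A| <o \<theta>" by (rule ordLeq_ordLess_trans[OF card_of_image A\<theta>])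
    have "Z = (\<lambda>a. (a, 0)) ` ?A" by (auto simp: Z_def)
    then have "|Z| <o \<theta>" using ordLeq_ordLess_trans[OF card_of_image A'\<theta>] by simp
    then have task: "(Z, f x) \<in> tasks"
      using AX f(1) x X(2) by (auto simp: tasks_def Z_def)
    have "|A \<union> ?A \<union> {x, f x}| <o \<theta>"
      by (intro Un_less_\<theta> A\<theta> A'\<theta> finite_less_\<theta>) simp
    moreover have "A \<union> ?A \<union> {x, f x} \<subseteq> pts X" using AX f(1) x by auto
    ultimately obtain S Q where S: "A \<union> ?A \<union> {x, f x} \<subseteq> pts S" "extends S X"
        and Q: "step S (Z, f x) Q" "extends Q X"
      using rich[OF _ _ task] by blast
    \<comment> \<open>The stage at which the image is spoiled must know \<open>A\<close> as a marker. It contains the points of \<open>A\<close>,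
      and markers that are added later are larger than it.\<close>
    have markS: "(x, A) \<in> marks S"
    proof (rule ccontr)
      assume "(x, A) \<notin> marks S"
      then have "|pts S| <o |A|" by (rule extendsD(4)[OF S(2) A(1)])
      moreover have "A \<subseteq> pts S" using S(1) by blast
      ultimately show False using ordLess_subset ordLess_irreflexive by blast
    qed
    have iso: "|fst ` Z| =o |A|"
    proof -
      have "inj_on f A" using bij AX by (auto simp: bij_betw_def intro: inj_on_subset)
      then have "|A| =o |?A|" by (rule card_of_ordIsoI[OF inj_on_imp_bij_betw])
      then show ?thesis unfolding fstZ by (rule ordIso_symmetric)
    qed
    have two: "dst S (f x) a = 2" if "a \<in> fst ` Z" for a
    proof -
      obtain b where b: "b \<in> A" "a = f b" using \<open>a \<in> fst ` Z\<close> unfolding fstZ by blast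
      have "dst X (f x) (f b) = 2"
        using f(2)[OF x, of b] b(1) AX mk by (auto simp: marker_def)
      then show ?thesis using extendsD(2)[OF S(2), of "f x" "f b"] S(1) b by auto
    qed
    have inS: "f x \<in> pts S" "fst ` Z \<subseteq> pts S" using S(1) fstZ by auto
    have "spoiled Q (f x) (fst ` Z)"
      by (rule step_spoiled[OF Q(1) inS(1) markS neq[symmetric] inS(2) iso two])
    then have "spoiled X (f x) ?A" unfolding fstZ by (rule spoiled_mono[OF Q(2)])
    then obtain p where p: "p \<in> pts X" "p \<noteq> f x" "\<not> |{a \<in> ?A. ?d p a \<le> 2}| <o |?A|"
      unfolding spoiled_def by blast
    obtain q where q: "q \<in> pts X" "p = f q" using p(1) bij by (auto simp: bij_betw_def)
    have qx: "0 < ?d q x" using p(2) q x by auto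
    have "{a \<in> ?A. ?d p a \<le> 2} \<subseteq> f ` {a \<in> A. ?d q a < 2 + min 1 (?d q x)}"
    proof clarify
      fix a assume a: "a \<in> A" "?d p (f a) \<le> 2"
      then have "?d q a \<le> 2" using f(2)[OF q(1), of a] AX q(2) by auto
      then have "?d q a < 2 + min 1 (?d q x)" using qx by linarith
      then show "f a \<in> f ` {a \<in> A. ?d q a < 2 + min 1 (?d q x)}" using a(1) by blast
    qed
    moreover have "|f ` {a \<in> A. ?d q a < 2 + min 1 (?d q x)}| <o |?A|"
    proof -
      have "|{a \<in> A. ?d q a < 2 + min 1 (?d q x)}| <o |A|"
        using mk q(1) by (simp add: marker_def)
      then have "|f ` {a \<in> A. ?d q a < 2 + min 1 (?d q x)}| <o |A|"
        by (rule ordLeq_ordLess_trans[OF card_of_image])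
      moreover have "|A| =o |?A|"
        using iso unfolding fstZ by (rule ordIso_symmetric)
      ultimately show ?thesis by (rule ordLess_ordIso_trans)
    qed
    ultimately show False using p(3) ordLess_subset by blast
  qed
qed

lemma one_type_realized:
  assumes rich_X: "rich_stage X" and Z: "one_type (pts X) (dst X) Z" "|Z| \<le>o \<kappa>"
  shows "realized X Z"
proof -
  note X = rich_stageD(1-3)[OF rich_X] and rich = rich_stageD(4)[OF rich_X]
  have "pts X \<noteq> {}"
  proof
    assume "pts X = {}"
    then have "|pts X| <o \<theta>" using finite_less_\<theta>[of "pts X"] by simp
    then show False using X(3) not_ordLess_ordIso by blast
  qed
  then obtain x where x: "x \<in> pts X" by blast
  show ?thesis
  proof (cases "Z = {}")
    case True
    then show ?thesis using x by (auto simp: realized_def)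
  next
    case False
    have Z\<theta>: "|Z| <o \<theta>" by (rule ordLeq_ordLess_trans[OF Z(2) \<kappa>_less])
    have sub: "fst ` Z \<subseteq> pts X" using Z(1) by (simp add: one_type_def)
    have "(Z, x) \<in> tasks" using sub X(2) x Z\<theta> by (force simp: tasks_def)
    moreover have "|fst ` Z| <o \<theta>" by (rule ordLeq_ordLess_trans[OF card_of_image Z\<theta>])
    ultimately obtain S Q where S: "fst ` Z \<subseteq> pts S" "extends S X" "step S (Z, x) Q" "extends Q X"
      using rich[OF sub] by blast
    have ZS: "s \<in> pts S" if "(s, r) \<in> Z" for s r using S(1) that by force
    have "one_type (pts S) (dst S) Z"
    proof (rule one_typeI)
      show "r \<le> q + dst S s t \<and> dst S s t \<le> r + q" if "(s, r) \<in> Z" "(t, q) \<in> Z" for s r t q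
        using one_typeD(2)[OF Z(1) that] extendsD(2)[OF S(2) ZS[OF that(1)] ZS[OF that(2)]] by simp
    qed (rule ZS)
    then have "realized Q Z" using S(3) False Z(2) by (simp add: step_def)
    then show ?thesis by (rule realized_mono[OF S(4)])
  qed
qed

text \<open>
  By Zorn's lemma it is enough to extend embeddings by one point, since no partial embedding of \<open>Y\<close> has
  a domain of more than \<open>\<kappa>\<close> points.
\<close>

lemma superuniversal_stage:
  assumes X: "valid_stage \<kappa> X"
    and ext: "\<And>Z. \<lbrakk>one_type (pts X) (dst X) Z; |Z| \<le>o \<kappa>\<rbrakk> \<Longrightarrow> realized X Z"
  shows "superuniversal \<kappa> (metric (pts X, dst X))"
  unfolding superuniversal_def
proof (intro allI impI)
  interpret Metric_space "pts X" "dst X" by (rule valid_stage_metric[OF X])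
  fix Y :: "'k metric" and S f
  assume asm: "|mspace Y| \<le>o \<kappa> \<and> S \<subseteq> mspace Y \<and> |S| <o \<kappa> \<and>
    isometric_embedding (submetric Y S) (metric (pts X, dst X)) f"
  then have S: "S \<subseteq> mspace Y" by blast
  have mS: "mspace (submetric Y S) = S" using S by auto
  have f: "f u \<in> pts X" "dst X (f u) (f v) = mdist Y u v" if "u \<in> S" "v \<in> S" for u v
    using asm that by (auto simp: isometric_embedding_def stage_metric[OF X] mS)
  \<comment> \<open>The partial embeddings as graphs; preserving distances makes them single-valued.\<close>
  define G where "G = {g. g \<subseteq> mspace Y \<times> pts X \<and> (\<lambda>s. (s, f s)) ` S \<subseteq> g \<and>
    (\<forall>(a, p)\<in>g. \<forall>(b, q)\<in>g. dst X p q = mdist Y a b)}"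
  have "\<exists>g\<in>G. \<forall>h\<in>G. g \<subseteq> h \<longrightarrow> h = g"
  proof (rule subset_Zorn_nonempty)
    have "(\<lambda>s. (s, f s)) ` S \<in> G" using S f by (auto simp: G_def)
    then show "G \<noteq> {}" by blast
    fix C assume C: "C \<noteq> {}" "subset.chain G C"
    then have CG: "C \<subseteq> G" by (simp add: subset_chain_def)
    have "dst X p q = mdist Y a b" if ab: "(a, p) \<in> \<Union>C" "(b, q) \<in> \<Union>C" for a p b q
    proof -
      obtain g h where gh: "g \<in> C" "h \<in> C" "(a, p) \<in> g" "(b, q) \<in> h" using ab by blast
      then have "g \<subseteq> h \<or> h \<subseteq> g" using C(2) by (simp add: subset_chain_def)
      then obtain k where "k \<in> C" "(a, p) \<in> k" "(b, q) \<in> k" using gh by blast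
      then show ?thesis using CG unfolding G_def by blast
    qed
    moreover have "\<Union>C \<subseteq> mspace Y \<times> pts X" using CG unfolding G_def by blast
    moreover have "(\<lambda>s. (s, f s)) ` S \<subseteq> \<Union>C" using C(1) CG unfolding G_def by blast
    ultimately show "\<Union>C \<in> G" unfolding G_def by blast
  qed
  then obtain g where g: "g \<in> G" and max: "\<And>h. \<lbrakk>h \<in> G; g \<subseteq> h\<rbrakk> \<Longrightarrow> h = g" by blast
  have gY: "a \<in> mspace Y" "p \<in> pts X" if "(a, p) \<in> g" for a p
    using g that unfolding G_def by blast+
  have gd: "dst X p q = mdist Y a b" if "(a, p) \<in> g" "(b, q) \<in> g" for a p b q
    using g that unfolding G_def by blast
  have gS: "(s, f s) \<in> g" if "s \<in> S" for s
    using g that unfolding G_def by blast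
  have guniq: "p = q" if "(a, p) \<in> g" "(a, q) \<in> g" for a p q
    using gd[OF that] zero[OF gY(2)[OF that(1)] gY(2)[OF that(2)]] gY(1)[OF that(1)] by simp
  have total: "\<exists>p. (y, p) \<in> g" if y: "y \<in> mspace Y" for y
  proof (rule ccontr)
    assume no: "\<nexists>p. (y, p) \<in> g"
    define Z where "Z = (\<lambda>(a, p). (p, mdist Y a y)) ` g"
    have "one_type (pts X) (dst X) Z"
    proof (rule one_typeI)
      fix s r assume "(s, r) \<in> Z"
      then show "s \<in> pts X" using gY by (auto simp: Z_def)
    next
      fix s r t q assume "(s, r) \<in> Z" "(t, q) \<in> Z"
      then obtain a b where ab: "(a, s) \<in> g" "r = mdist Y a y" "(b, t) \<in> g" "q = mdist Y b y"
        by (auto simp: Z_def)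
      have "a \<in> mspace Y" "b \<in> mspace Y" using gY ab by blast+
      then show "r \<le> q + dst X s t \<and> dst X s t \<le> r + q"
        using gd[OF ab(1,3)] ab(2,4) mdist_triangle[of a Y b y] mdist_triangle[of a Y y b] y
        by (simp add: mdist_commute)
    qed
    moreover have "|Z| \<le>o \<kappa>"
    proof -
      have "inj_on fst g" by (rule inj_onI) (use guniq in force)
      then have "|g| \<le>o |mspace Y|" by (rule card_of_ordLeqI) (use gY in force)
      then have "|Z| \<le>o |mspace Y|"
        unfolding Z_def by (rule ordLeq_transitive[OF card_of_image])
      then show ?thesis using asm by (blast intro: ordLeq_transitive)
    qed
    ultimately have "realized X Z" by (rule ext)
    then obtain p where p: "p \<in> pts X" "\<forall>(s, r)\<in>Z. s \<in> pts X \<and> dst X p s = r"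
      unfolding realized_def by blast
    have pg: "dst X p q = mdist Y y a" "dst X q p = mdist Y a y" if "(a, q) \<in> g" for a q
    proof -
      have "(q, mdist Y a y) \<in> Z" using that by (force simp: Z_def)
      then show "dst X p q = mdist Y y a" "dst X q p = mdist Y a y"
        using p(2) by (auto simp: commute[of q] mdist_commute[of Y y])
    qed
    have "insert (y, p) g \<in> G"
      using g gY gd p(1) y pg unfolding G_def by auto
    then have "insert (y, p) g = g" by (rule max) blast
    then show False using no by blast
  qed
  define F where "F y = (SOME p. (y, p) \<in> g)" for y
  have F: "(y, F y) \<in> g" if "y \<in> mspace Y" for y
    unfolding F_def by (rule someI_ex[OF total[OF that]])
  have "isometric_embedding Y (metric (pts X, dst X)) F"
    unfolding isometric_embedding_def stage_metric[OF X] using F gY gd by blast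
  moreover have "F y = f y" if "y \<in> S" for y
    by (rule guniq[OF F gS[OF that]]) (use S that in blast)
  ultimately show "\<exists>h. isometric_embedding Y (metric (pts X, dst X)) h \<and> (\<forall>y\<in>S. h y = f y)"
    by blast
qed

end

theorem corollary6p14:
  fixes \<kappa> :: "'k rel" and \<theta> :: "'l rel"
  assumes "Card_order \<kappa>" and "natLeq <o \<kappa>"
    and "strongly_inaccessible \<theta>" and "\<kappa> <o \<theta>"
  shows "\<exists>X :: 'l metric. superuniversal \<kappa> X \<and> rigid_metric X \<and> |mspace X| =o \<theta>"
proof -
  interpret below_inaccessible \<kappa> \<theta> by unfold_locales (rule assms)+
  obtain X where X: "rich_stage X" using rich_stage_exists by blast
  have "superuniversal \<kappa> (metric (pts X, dst X))"
    by (rule superuniversal_stage[OF rich_stageD(1)[OF X] one_type_realized[OF X]])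
  moreover have "rigid_metric (metric (pts X, dst X))"
    by (rule rigid_rich_stage[OF X])
  ultimately show ?thesis
    using rich_stageD(3)[OF X] stage_metric(1)[OF rich_stageD(1)[OF X]]
    by (intro exI[of _ "metric (pts X, dst X)"]) simp
qed

end
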